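(* Let $\pi$ be an $\mathcal{S}$-smooth spectral measure on $(\Sigma,\mathscr{A},\mu)$, and let $\Phi,\Psi \in \mathcal{S}^*$ be integrable with respect to $\pi$. Then, for all $\alpha,\beta\in \mathbb{C}$, $\alpha \Phi + \beta \Psi$ is integrable with respect to $\pi$, and moreover $$\int_{\Sigma}\big(\alpha \Phi + \beta \Psi\big)d\pi = \alpha\int_{\Sigma} \Phi\, d\pi + \beta\int_{\Sigma}\Psi\, d\pi.$$
   Context: $\mathbb{N}=\{0,1,2,\dots\}$ and $\Gamma$ is the set of all finite subsets of $\mathbb{N}$. Bernoulli space: $\Sigma=\{-1,1\}^{\mathbb{N}}$, $\zeta_n(\omega)=\omega(n)$ for $\omega\in\Sigma$, $\mathscr{A}$ is the $\sigma$-field generated by $(\zeta_n)_{n\ge 0}$, $(\theta_n)_{n\ge0}$ is a given sequence with $0<\theta_n<1$, and $\mu$ is the unique probability measure on $\mathscr{A}$ under which the $\zeta_n$ are independent with $\mu(\zeta_n=1)=\theta_n$, $\mu(\zeta_n=-1)=1-\theta_n$. Put $Z_n=\frac{\zeta_n+1-2\theta_n}{2\sqrt{\theta_n(1-\theta_n)}}$, $Z_\emptyset=1$ and $Z_\sigma=\prod_{i\in\sigma}Z_i$ for nonempty $\sigma\in\Gamma$. $\mathcal{L}^2=\mathcal{L}^2(\Sigma,\mathscr{A},\mu)$ is the complex Hilbert space with inner product $\langle\xi,\eta\rangle=\int_\Sigma\overline{\xi}\eta\,d\mu$; $\{Z_\sigma\mid\sigma\in\Gamma\}$ is an orthonormal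 basis of $\mathcal{L}^2$. Define $\lambda_\emptyset=1$ and $\lambda_\sigma=\prod_{k\in\sigma}(1+k)$ for nonempty $\sigma\in\Gamma$. For real $p\ge0$, $\mathcal{S}_p=\{\xi\in\mathcal{L}^2\mid \sum_{\sigma\in\Gamma}\lambda_\sigma^{2p}|\langle Z_\sigma,\xi\rangle|^2<\infty\}$, a Hilbert space with norm $\|\xi\|_p=\big(\sum_{\sigma\in\Gamma}\lambda_\sigma^{2p}|\langle Z_\sigma,\xi\rangle|^2\big)^{1/2}$. $\mathcal{S}=\bigcap_{p\ge0}\mathcal{S}_p$ carries the topology generated by the norms $\|\cdot\|_p$, $p\ge0$ (each $Z_\sigma\in\mathcal{S}$). $\mathcal{S}^*$ is the dual of $\mathcal{S}$ (continuous linear functionals) with the strong topology; its elements are called Bernoulli generalized functionals. The bilinear pairing on $\mathcal{S}^*\times\mathcal{S}$ is $\langle\!\langle\Phi,\xi\rangle\!\rangle=\Phi(\xi)$. $\mathfrak{L}(\mathcal{S},\mathcal{S}^* )$ is the space of continuous linear operators from $\mathcal{S}$ to $\mathcal{S}^*$. The 2D-Fock transform of $\mathsf{T}\colon\mathcal{S}\to\mathcal{S}^*$ is $\widehat{\mathsf{T}}(\sigma,\tau)=\langle\!\langle\mathsf{T}Z_\sigma,Z_\tau\rangle\!\rangle$, $\sigma,\tau\in\Gamma$. Known fact: elements of $\mathfrak{L}(\mathcal{S},\mathcal{S}^* )$ are determined by their 2D-Fock transforms, and a function $G$ on $\Gamma\times\Gamma$ is the 2D-Fock transform of some $\mathsf{T}\in\mathfrak{L}(\mathcal{S},\mathcal{S}^*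 )$ if and only if $|G(\sigma,\tau)|\le C\lambda_\sigma^p\lambda_\tau^p$ for all $\sigma,\tau\in\Gamma$, for some constants $C,p\ge0$. $\mathfrak{P}(\mathcal{L}^2)$ is the set of orthogonal projection operators on $\mathcal{L}^2$. A mapping $\pi\colon\mathscr{A}\to\mathfrak{P}(\mathcal{L}^2)$ is a spectral measure on $(\Sigma,\mathscr{A},\mu)$ if $\pi(\Sigma)=I$ and $\pi(\bigcup_{n\ge1}E_n)=\sum_{n\ge1}\pi(E_n)$, with convergence in the strong operator topology, for every sequence $(E_n)_{n\ge1}\subset\mathscr{A}$ of pairwise disjoint sets. It is $\mathcal{S}$-smooth if for each $(\sigma,\tau)\in\Gamma\times\Gamma$ there exists $\phi_{\sigma,\tau}^{\pi}\in\mathcal{S}$ (the numerical spectral density of $\pi$ associated with $(\sigma,\tau)$) such that $\langle\pi(E)Z_\sigma,Z_\tau\rangle=\int_E\phi_{\sigma,\tau}^{\pi}\,d\mu$ for all $E\in\mathscr{A}$. For an $\mathcal{S}$-smooth spectral measure $\pi$, $\Phi\in\mathcal{S}^*$ is integrable with respect to $\pi$ if there exist constants $C\ge0$, $p\ge0$ such that $|\langle\!\langle\Phi,\phi_{\sigma,\tau}^{\pi}\rangle\!\rangle|\le C\lambda_\sigma^p\lambda_\tau^p$ for all $(\sigma,\tau)\in\Gamma\times\Gamma$. In that case the spectral integral $\int_\Sigma\Phi\,d\pi$ is the unique operator in $\mathfrak{L}(\mathcal{S},\mathcal{S}^* )$ whose 2D-Fock transform is $(\sigma,\tau)\mapsto\langle\!\langle\Phi,\phi_{\sigma,\tau}^{\pi}\rangle\!\rangle$.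 *)

theory Defs
  imports "HOL-Probability.Probability"
begin

text \<open>
  Elements of \<open>L\<^sup>2\<close> are represented by square-integrable functions; two of them denote the same
  vector iff they agree almost everywhere. All notions below depend only on the vector denoted.
\<close>

type_synonym path = "nat \<Rightarrow> real"
type_synonym rv = "path \<Rightarrow> complex"

definition Gam :: "nat set set" where
  "Gam = {\<sigma>. finite \<sigma>}"

subsection \<open>Bernoulli space\<close>

definition bernoulli_measure :: "(nat \<Rightarrow> real) \<Rightarrow> path measure" where
  "bernoulli_measure \<theta> =
     (\<Pi>\<^sub>M n\<in>UNIV. point_measure {-1, 1} (\<lambda>x. ennreal (if x = 1 then \<theta> n else 1 - \<theta> n)))"

definition zeta :: "nat \<Rightarrow> path \<Rightarrow> real" where
  "zeta n \<omega> = \<omega> n"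

definition Zn :: "(nat \<Rightarrow> real) \<Rightarrow> nat \<Rightarrow> path \<Rightarrow> real" where
  "Zn \<theta> n \<omega> = (zeta n \<omega> + 1 - 2 * \<theta> n) / (2 * sqrt (\<theta> n * (1 - \<theta> n)))"

definition Z :: "(nat \<Rightarrow> real) \<Rightarrow> nat set \<Rightarrow> rv" where
  "Z \<theta> \<sigma> \<omega> = complex_of_real (\<Prod>i\<in>\<sigma>. Zn \<theta> i \<omega>)"

subsection \<open>The space \<open>L\<^sup>2\<close>\<close>

definition L2 :: "(nat \<Rightarrow> real) \<Rightarrow> rv set" where
  "L2 \<theta> = {\<xi> \<in> borel_measurable (bernoulli_measure \<theta>).
             integrable (bernoulli_measure \<theta>) (\<lambda>\<omega>. (cmod (\<xi> \<omega>))\<^sup>2)}"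

definition L2_eq :: "(nat \<Rightarrow> real) \<Rightarrow> rv \<Rightarrow> rv \<Rightarrow> bool" where
  "L2_eq \<theta> \<xi> \<eta> \<longleftrightarrow> (AE \<omega> in bernoulli_measure \<theta>. \<xi> \<omega> = \<eta> \<omega>)"

definition L2_inner :: "(nat \<Rightarrow> real) \<Rightarrow> rv \<Rightarrow> rv \<Rightarrow> complex" where
  "L2_inner \<theta> \<xi> \<eta> = (LINT \<omega>|bernoulli_measure \<theta>. cnj (\<xi> \<omega>) * \<eta> \<omega>)"

definition L2_norm :: "(nat \<Rightarrow> real) \<Rightarrow> rv \<Rightarrow> real" where
  "L2_norm \<theta> \<xi> = sqrt (LINT \<omega>|bernoulli_measure \<theta>. (cmod (\<xi> \<omega>))\<^sup>2)"

subsection \<open>Testing functionals\<close>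

definition lam :: "nat set \<Rightarrow> real" where
  "lam \<sigma> = (\<Prod>k\<in>\<sigma>. 1 + real k)"

definition S_space :: "(nat \<Rightarrow> real) \<Rightarrow> real \<Rightarrow> rv set" where
  "S_space \<theta> p = {\<xi> \<in> L2 \<theta>.
     (\<lambda>\<sigma>. lam \<sigma> powr (2 * p) * (cmod (L2_inner \<theta> (Z \<theta> \<sigma>) \<xi>))\<^sup>2) summable_on Gam}"

definition S_norm :: "(nat \<Rightarrow> real) \<Rightarrow> real \<Rightarrow> rv \<Rightarrow> real" where
  "S_norm \<theta> p \<xi> =
     sqrt (\<Sum>\<^sub>\<infinity>\<sigma>\<in>Gam. lam \<sigma> powr (2 * p) * (cmod (L2_inner \<theta> (Z \<theta> \<sigma>) \<xi>))\<^sup>2)"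

definition S :: "(nat \<Rightarrow> real) \<Rightarrow> rv set" where
  "S \<theta> = (\<Inter>p\<in>{0..}. S_space \<theta> p)"

definition S_topology :: "(nat \<Rightarrow> real) \<Rightarrow> rv topology" where
  "S_topology \<theta> = topology_generated_by
     {{\<eta> \<in> S \<theta>. S_norm \<theta> p (\<lambda>\<omega>. \<eta> \<omega> - \<xi> \<omega>) < r} | \<xi> p r. \<xi> \<in> S \<theta> \<and> 0 \<le> p \<and> 0 < r}"

definition S_bounded :: "(nat \<Rightarrow> real) \<Rightarrow> rv set \<Rightarrow> bool" where
  "S_bounded \<theta> B \<longleftrightarrow> B \<subseteq> S \<theta> \<and> (\<forall>p\<ge>0. bdd_above (S_norm \<theta> p ` B))"

subsection \<open>Generalized functionals and operators\<close>

text \<open>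
  Functionals on \<open>S\<close>, and operators from \<open>S\<close> to its dual, are total functions that vanish outside
  \<open>S\<close>. This makes the representing function unique, and the vector space operations are pointwise.
  Continuity together with linearity forces them to identify almost everywhere equal arguments.
\<close>

definition S_dual :: "(nat \<Rightarrow> real) \<Rightarrow> (rv \<Rightarrow> complex) set" where
  "S_dual \<theta> = {\<Phi>.
     (\<forall>\<xi>. \<xi> \<notin> S \<theta> \<longrightarrow> \<Phi> \<xi> = 0) \<and>
     (\<forall>\<xi>\<in>S \<theta>. \<forall>\<eta>\<in>S \<theta>. \<forall>a b. \<Phi> (\<lambda>\<omega>. a * \<xi> \<omega> + b * \<eta> \<omega>) = a * \<Phi> \<xi> + b * \<Phi> \<eta>) \<and>
     continuous_map (S_topology \<theta>) euclidean \<Phi>}"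

text \<open>The strong topology: uniform convergence on bounded subsets of \<open>S\<close>.\<close>

definition S_dual_topology :: "(nat \<Rightarrow> real) \<Rightarrow> (rv \<Rightarrow> complex) topology" where
  "S_dual_topology \<theta> = topology_generated_by
     {{\<Psi> \<in> S_dual \<theta>. (SUP \<xi>\<in>B. cmod (\<Psi> \<xi> - \<Phi> \<xi>)) < r} | \<Phi> B r.
        \<Phi> \<in> S_dual \<theta> \<and> S_bounded \<theta> B \<and> B \<noteq> {} \<and> 0 < r}"

definition S_operators :: "(nat \<Rightarrow> real) \<Rightarrow> (rv \<Rightarrow> rv \<Rightarrow> complex) set" where
  "S_operators \<theta> = {T.
     (\<forall>\<xi>. \<xi> \<notin> S \<theta> \<longrightarrow> T \<xi> = (\<lambda>\<eta>. 0)) \<and>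
     (\<forall>\<xi>\<in>S \<theta>. T \<xi> \<in> S_dual \<theta>) \<and>
     (\<forall>\<xi>\<in>S \<theta>. \<forall>\<eta>\<in>S \<theta>. \<forall>a b.
        T (\<lambda>\<omega>. a * \<xi> \<omega> + b * \<eta> \<omega>) = (\<lambda>\<zeta>. a * T \<xi> \<zeta> + b * T \<eta> \<zeta>)) \<and>
     continuous_map (S_topology \<theta>) (S_dual_topology \<theta>) T}"

definition fock2D :: "(nat \<Rightarrow> real) \<Rightarrow> (rv \<Rightarrow> rv \<Rightarrow> complex) \<Rightarrow> nat set \<Rightarrow> nat set \<Rightarrow> complex" where
  "fock2D \<theta> T \<sigma> \<tau> = T (Z \<theta> \<sigma>) (Z \<theta> \<tau>)"

subsection \<open>Spectral measures and spectral integrals\<close>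

definition orthogonal_projection :: "(nat \<Rightarrow> real) \<Rightarrow> (rv \<Rightarrow> rv) \<Rightarrow> bool" where
  "orthogonal_projection \<theta> P \<longleftrightarrow>
     (\<forall>\<xi>\<in>L2 \<theta>. P \<xi> \<in> L2 \<theta>) \<and>
     (\<forall>\<xi>\<in>L2 \<theta>. \<forall>\<eta>\<in>L2 \<theta>. L2_eq \<theta> \<xi> \<eta> \<longrightarrow> L2_eq \<theta> (P \<xi>) (P \<eta>)) \<and>
     (\<forall>\<xi>\<in>L2 \<theta>. \<forall>\<eta>\<in>L2 \<theta>. \<forall>a b.
        L2_eq \<theta> (P (\<lambda>\<omega>. a * \<xi> \<omega> + b * \<eta> \<omega>)) (\<lambda>\<omega>. a * P \<xi> \<omega> + b * P \<eta> \<omega>)) \<and>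
     (\<exists>C. \<forall>\<xi>\<in>L2 \<theta>. L2_norm \<theta> (P \<xi>) \<le> C * L2_norm \<theta> \<xi>) \<and>
     (\<forall>\<xi>\<in>L2 \<theta>. L2_eq \<theta> (P (P \<xi>)) (P \<xi>)) \<and>
     (\<forall>\<xi>\<in>L2 \<theta>. \<forall>\<eta>\<in>L2 \<theta>. L2_inner \<theta> (P \<xi>) \<eta> = L2_inner \<theta> \<xi> (P \<eta>))"

definition spectral_measure :: "(nat \<Rightarrow> real) \<Rightarrow> (path set \<Rightarrow> rv \<Rightarrow> rv) \<Rightarrow> bool" where
  "spectral_measure \<theta> \<pi> \<longleftrightarrow>
     (\<forall>E\<in>sets (bernoulli_measure \<theta>). orthogonal_projection \<theta> (\<pi> E)) \<and>
     (\<forall>\<xi>\<in>L2 \<theta>. L2_eq \<theta> (\<pi> (space (bernoulli_measure \<theta>)) \<xi>) \<xi>) \<and>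
     (\<forall>E :: nat \<Rightarrow> path set. range E \<subseteq> sets (bernoulli_measure \<theta>) \<and> disjoint_family E \<longrightarrow>
        (\<forall>\<xi>\<in>L2 \<theta>. (\<lambda>N. L2_norm \<theta> (\<lambda>\<omega>. (\<Sum>n<N. \<pi> (E n) \<xi> \<omega>) - \<pi> (\<Union>n. E n) \<xi> \<omega>))
                     \<longlonglongrightarrow> 0))"

definition is_spectral_density ::
    "(nat \<Rightarrow> real) \<Rightarrow> (path set \<Rightarrow> rv \<Rightarrow> rv) \<Rightarrow> nat set \<Rightarrow> nat set \<Rightarrow> rv \<Rightarrow> bool" where
  "is_spectral_density \<theta> \<pi> \<sigma> \<tau> \<phi> \<longleftrightarrow> \<phi> \<in> S \<theta> \<and>
     (\<forall>E\<in>sets (bernoulli_measure \<theta>).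
        L2_inner \<theta> (\<pi> E (Z \<theta> \<sigma>)) (Z \<theta> \<tau>) = (LINT \<omega>:E|bernoulli_measure \<theta>. \<phi> \<omega>))"

definition S_smooth :: "(nat \<Rightarrow> real) \<Rightarrow> (path set \<Rightarrow> rv \<Rightarrow> rv) \<Rightarrow> bool" where
  "S_smooth \<theta> \<pi> \<longleftrightarrow> (\<forall>\<sigma>\<in>Gam. \<forall>\<tau>\<in>Gam. \<exists>\<phi>. is_spectral_density \<theta> \<pi> \<sigma> \<tau> \<phi>)"

text \<open>A spectral density is unique up to almost everywhere equality, so the choice is immaterial.\<close>

definition spectral_density ::
    "(nat \<Rightarrow> real) \<Rightarrow> (path set \<Rightarrow> rv \<Rightarrow> rv) \<Rightarrow> nat set \<Rightarrow> nat set \<Rightarrow> rv" where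
  "spectral_density \<theta> \<pi> \<sigma> \<tau> = (SOME \<phi>. is_spectral_density \<theta> \<pi> \<sigma> \<tau> \<phi>)"

definition spectral_integrable ::
    "(nat \<Rightarrow> real) \<Rightarrow> (path set \<Rightarrow> rv \<Rightarrow> rv) \<Rightarrow> (rv \<Rightarrow> complex) \<Rightarrow> bool" where
  "spectral_integrable \<theta> \<pi> \<Phi> \<longleftrightarrow> \<Phi> \<in> S_dual \<theta> \<and>
     (\<exists>C\<ge>0. \<exists>p\<ge>0. \<forall>\<sigma>\<in>Gam. \<forall>\<tau>\<in>Gam.
        cmod (\<Phi> (spectral_density \<theta> \<pi> \<sigma> \<tau>)) \<le> C * lam \<sigma> powr p * lam \<tau> powr p)"

definition spectral_integral ::
    "(nat \<Rightarrow> real) \<Rightarrow> (path set \<Rightarrow> rv \<Rightarrow> rv) \<Rightarrow> (rv \<Rightarrow> complex) \<Rightarrow> rv \<Rightarrow> rv \<Rightarrow> complex" where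
  "spectral_integral \<theta> \<pi> \<Phi> = (THE T. T \<in> S_operators \<theta> \<and>
     (\<forall>\<sigma>\<in>Gam. \<forall>\<tau>\<in>Gam. fock2D \<theta> T \<sigma> \<tau> = \<Phi> (spectral_density \<theta> \<pi> \<sigma> \<tau>)))"

subsection \<open>The product measure is the Bernoulli measure\<close>

lemma space_bernoulli_measure: "space (bernoulli_measure \<theta>) = {\<omega>. \<forall>n. \<omega> n \<in> {-1, 1}}"
  by (auto simp: bernoulli_measure_def space_PiM space_point_measure)

lemma prob_space_bernoulli_factor:
  assumes "0 < t" "t < 1"
  shows "prob_space (point_measure {-1, 1::real} (\<lambda>x. ennreal (if x = 1 then t else 1 - t)))"
  using assms
  by (intro prob_spaceI)
     (simp add: space_point_measure emeasure_point_measure_finite flip: ennreal_plus ennreal_1)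

lemma
  assumes "\<And>n. 0 < \<theta> n" "\<And>n. \<theta> n < 1"
  shows prob_space_bernoulli_measure: "prob_space (bernoulli_measure \<theta>)"
    and measure_zeta_1:
      "measure (bernoulli_measure \<theta>) {\<omega> \<in> space (bernoulli_measure \<theta>). zeta n \<omega> = 1} = \<theta> n"
    and measure_zeta_neg1:
      "measure (bernoulli_measure \<theta>) {\<omega> \<in> space (bernoulli_measure \<theta>). zeta n \<omega> = -1} = 1 - \<theta> n"
    and indep_vars_zeta:
      "prob_space.indep_vars (bernoulli_measure \<theta>) (\<lambda>_. borel) zeta UNIV"
proof -
  let ?F = "\<lambda>n. point_measure {-1, 1::real} (\<lambda>x. ennreal (if x = 1 then \<theta> n else 1 - \<theta> n))"
  have F: "prob_space (?F n)" for n
    using assms by (rule prob_space_bernoulli_factor)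
  interpret P: product_prob_space ?F UNIV
    using F by (simp add: product_prob_space_def product_sigma_finite_def
        product_prob_space_axioms_def prob_space_imp_sigma_finite)
  show "prob_space (bernoulli_measure \<theta>)"
    unfolding bernoulli_measure_def by (rule P.prob_space_axioms)
  have m: "measure (bernoulli_measure \<theta>) {\<omega> \<in> space (bernoulli_measure \<theta>). zeta n \<omega> = x} =
      measure (?F n) {x}" if "x \<in> {-1, 1}" for x
  proof -
    have "{\<omega> \<in> space (bernoulli_measure \<theta>). zeta n \<omega> = x} =
        {\<omega> \<in> space (bernoulli_measure \<theta>). \<omega> n \<in> {x}}"
      by (simp add: zeta_def)
    then show ?thesis
      using P.emeasure_PiM_Collect_single[of n "{x}"] that
      by (simp add: measure_def bernoulli_measure_def sets_point_measure)
  qed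
  show "measure (bernoulli_measure \<theta>) {\<omega> \<in> space (bernoulli_measure \<theta>). zeta n \<omega> = 1} = \<theta> n"
    using assms[of n] by (subst m) (auto simp: measure_def emeasure_point_measure_finite)
  show "measure (bernoulli_measure \<theta>) {\<omega> \<in> space (bernoulli_measure \<theta>). zeta n \<omega> = -1} = 1 - \<theta> n"
    using assms[of n] by (subst m) (auto simp: measure_def emeasure_point_measure_finite)
  have "P.indep_vars ?F (\<lambda>n \<omega>. \<omega> n) UNIV"
    by (subst P.indep_vars_iff_distr_eq_PiM')
       (simp_all add: restrict_UNIV P.PiM_component distr_id2 measurable_component_singleton
         del: measurable_point_measure_eq2_finite)
  then have "P.indep_vars (\<lambda>_. borel) (\<lambda>n \<omega>. id (\<omega> n)) UNIV"
    by (rule P.indep_vars_compose2) auto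
  then show "prob_space.indep_vars (bernoulli_measure \<theta>) (\<lambda>_. borel) zeta UNIV"
    by (simp add: bernoulli_measure_def zeta_def[abs_def])
qed

end

theory Submission
  imports Defs
begin

text \<open>
  By orthonormality of the \<open>Z\<^sub>\<sigma>\<close>, the finite partial sums of the expansion of \<open>\<xi> \<in> S\<close> converge to
  \<open>\<xi>\<close> in every norm \<open>\<parallel>\<cdot>\<parallel>\<^sub>p\<close>, so a continuous functional on \<open>S\<close>, and hence a separately continuous
  bilinear form, is determined by its values on the \<open>Z\<^sub>\<sigma>\<close>. Conversely, since
  \<open>\<Sum>\<^sub>\<sigma> \<lambda>\<^sub>\<sigma>\<^bsup>-2\<^esup> = \<Prod>\<^sub>k (1 + 1/(k+1)\<^sup>2) < \<infinity>\<close>, a kernel bounded by \<open>C \<lambda>\<^sub>\<sigma>\<^sup>p \<lambda>\<^sub>\<tau>\<^sup>p\<close> defines a bilinear form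
  bounded by \<open>\<parallel>\<xi>\<parallel>\<^bsub>p+1\<^esub> \<parallel>\<eta>\<parallel>\<^bsub>p+1\<^esub>\<close>. So spectral integrals exist and are unique, and the two sides
  of the claim agree because their 2D-Fock transforms do. Comparing them as separately continuous
  forms avoids showing that operators into the strong dual are closed under linear combinations.
\<close>

section \<open>Inequalities for square-summable families over arbitrary index sets\<close>

lemma l2_scale:
  fixes f :: "'a \<Rightarrow> real"
  shows "sqrt (\<Sum>\<^sub>\<infinity>x\<in>A. (k * f x)\<^sup>2) = \<bar>k\<bar> * sqrt (\<Sum>\<^sub>\<infinity>x\<in>A. (f x)\<^sup>2)"
  by (simp add: power_mult_distrib infsum_cmult_right' real_sqrt_mult)

lemma L2_set_le_infsum:
  fixes f :: "'a \<Rightarrow> real"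
  assumes "(\<lambda>x. (f x)\<^sup>2) summable_on A" "finite F" "F \<subseteq> A"
  shows "L2_set f F \<le> sqrt (\<Sum>\<^sub>\<infinity>x\<in>A. (f x)\<^sup>2)"
  unfolding L2_set_def using assms by (auto intro!: finite_sum_le_infsum)

text \<open>Minkowski's inequality. The finite version bounds all finite partial sums by one
  constant; as the terms are nonnegative, this gives summability, and the bound passes to the
  infinite sum.\<close>

lemma
  fixes f g :: "'a \<Rightarrow> real"
  assumes f: "(\<lambda>x. (f x)\<^sup>2) summable_on A" and g: "(\<lambda>x. (g x)\<^sup>2) summable_on A"
  shows l2_add_summable: "(\<lambda>x. (f x + g x)\<^sup>2) summable_on A"
    and l2_triangle: "sqrt (\<Sum>\<^sub>\<infinity>x\<in>A. (f x + g x)\<^sup>2)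
      \<le> sqrt (\<Sum>\<^sub>\<infinity>x\<in>A. (f x)\<^sup>2) + sqrt (\<Sum>\<^sub>\<infinity>x\<in>A. (g x)\<^sup>2)" (is "_ \<le> ?b")
proof -
  have bound: "(\<Sum>x\<in>F. (f x + g x)\<^sup>2) \<le> ?b\<^sup>2" if "finite F" "F \<subseteq> A" for F
  proof -
    have "L2_set (\<lambda>x. f x + g x) F \<le> L2_set f F + L2_set g F"
      by (rule L2_set_triangle_ineq)
    also have "\<dots> \<le> ?b"
      using L2_set_le_infsum[OF f that] L2_set_le_infsum[OF g that] by simp
    finally have "sqrt (\<Sum>x\<in>F. (f x + g x)\<^sup>2) \<le> ?b"
      by (simp add: L2_set_def)
    then show ?thesis by (rule sqrt_le_D)
  qed
  then show s: "(\<lambda>x. (f x + g x)\<^sup>2) summable_on A"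
    by (intro nonneg_bdd_above_summable_on bdd_aboveI2[where M="?b\<^sup>2"]) auto
  have "(\<Sum>\<^sub>\<infinity>x\<in>A. (f x + g x)\<^sup>2) \<le> ?b\<^sup>2"
    using s bound by (rule infsum_le_finite_sums)
  then show "sqrt (\<Sum>\<^sub>\<infinity>x\<in>A. (f x + g x)\<^sup>2) \<le> ?b"
    by (intro real_le_lsqrt) (auto intro!: add_nonneg_nonneg infsum_nonneg)
qed

text \<open>Cauchy-Schwarz, obtained from its finite version in the same way; nonnegativity is what
  turns bounded finite sums into summability.\<close>

lemma
  fixes f g :: "'a \<Rightarrow> real"
  assumes f: "(\<lambda>x. (f x)\<^sup>2) summable_on A" and g: "(\<lambda>x. (g x)\<^sup>2) summable_on A"
    and nonneg: "\<And>x. x \<in> A \<Longrightarrow> 0 \<le> f x" "\<And>x. x \<in> A \<Longrightarrow> 0 \<le> g x"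
  shows l2_mult_summable: "(\<lambda>x. f x * g x) summable_on A"
    and l2_Cauchy_Schwarz: "(\<Sum>\<^sub>\<infinity>x\<in>A. f x * g x)
      \<le> sqrt (\<Sum>\<^sub>\<infinity>x\<in>A. (f x)\<^sup>2) * sqrt (\<Sum>\<^sub>\<infinity>x\<in>A. (g x)\<^sup>2)" (is "_ \<le> ?b")
proof -
  have bound: "(\<Sum>x\<in>F. f x * g x) \<le> ?b" if "finite F" "F \<subseteq> A" for F
  proof -
    have "(\<Sum>x\<in>F. f x * g x) \<le> (\<Sum>x\<in>F. \<bar>f x\<bar> * \<bar>g x\<bar>)"
      by (intro sum_mono) (metis abs_ge_self abs_mult)
    also have "\<dots> \<le> L2_set f F * L2_set g F"
      by (rule L2_set_mult_ineq)
    also have "\<dots> \<le> ?b"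
      using L2_set_le_infsum[OF f that] L2_set_le_infsum[OF g that]
      by (intro mult_mono) (auto intro!: infsum_nonneg)
    finally show ?thesis .
  qed
  then show s: "(\<lambda>x. f x * g x) summable_on A"
    using nonneg
    by (intro nonneg_bdd_above_summable_on bdd_aboveI2[where M="?b"]) auto
  show "(\<Sum>\<^sub>\<infinity>x\<in>A. f x * g x) \<le> ?b"
    using s bound by (rule infsum_le_finite_sums)
qed

lemma infsum_lincomb:
  fixes f g :: "'a \<Rightarrow> complex"
  assumes "f summable_on A" "g summable_on A"
  shows "(\<Sum>\<^sub>\<infinity>x\<in>A. a * f x + b * g x) = a * infsum f A + b * infsum g A"
  using assms by (simp add: infsum_add summable_on_cmult_right infsum_cmult_right')

section \<open>The weights \<open>lam\<close> and the summability of their inverse squares\<close>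

lemma lam_ge_1: "1 \<le> lam \<sigma>"
  unfolding lam_def by (rule prod_ge_1) simp

lemma lam_powr_mono: "p \<le> q \<Longrightarrow> lam \<sigma> powr p \<le> lam \<sigma> powr q"
  by (intro powr_mono lam_ge_1)

lemma lam_pos: "0 < lam \<sigma>"
  using lam_ge_1[of \<sigma>] by linarith

lemma lam_powr_square: "lam \<sigma> powr (2 * p) * x\<^sup>2 = (lam \<sigma> powr p * x)\<^sup>2"
proof -
  have "lam \<sigma> powr (2 * p) = (lam \<sigma> powr p)\<^sup>2"
    by (simp only: mult_2 powr_add power2_eq_square)
  then show ?thesis by (simp add: power_mult_distrib)
qed

text \<open>Finitely many finite sets all lie in \<open>Pow {..<n}\<close> for some
  \<open>n\<close>. Over that power set the sum of products factors into a product of terms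
  \<open>?a k + 1\<close>, each at most \<open>exp (?a k)\<close>, and the exponents add up to at
  most the Basel sum. The square is kept visible because the family serves as a factor in
  Cauchy-Schwarz.\<close>

lemma lam_inverse_square_summable: "(\<lambda>\<sigma>. (lam \<sigma> powr - 1)\<^sup>2) summable_on Gam"
proof -
  let ?a = "\<lambda>k::nat. 1 / (real k + 1)\<^sup>2"
  have eq: "(lam \<sigma> powr - 1)\<^sup>2 = (\<Prod>k\<in>\<sigma>. ?a k)" for \<sigma>
  proof -
    have "lam \<sigma> powr - 1 = inverse (lam \<sigma>)"
      using lam_pos[of \<sigma>] by (simp add: powr_minus)
    then show ?thesis
      by (simp add: lam_def prod_power_distrib power_inverse prod_dividef inverse_eq_divide add.commute
        power_one_over)
  qed
  have "(\<Sum>\<sigma>\<in>F. (lam \<sigma> powr - 1)\<^sup>2) \<le> exp (pi\<^sup>2 / 6)" if F: "finite F" "F \<subseteq> Gam" for F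
  proof -
    have "finite (\<Union>F)"
      using F by (auto simp: Gam_def)
    then obtain n where "\<Union>F \<subseteq> {..<n}"
      using finite_nat_bounded by blast
    then have "F \<subseteq> Pow {..<n}" by auto
    then have "(\<Sum>\<sigma>\<in>F. (lam \<sigma> powr - 1)\<^sup>2) \<le> (\<Sum>\<sigma>\<in>Pow {..<n}. (lam \<sigma> powr - 1)\<^sup>2)"
      by (intro sum_mono2) auto
    also have "\<dots> = (\<Prod>k<n. ?a k + 1)"
      unfolding eq by (subst prod_add) simp_all
    also have "\<dots> \<le> (\<Prod>k<n. exp (?a k))"
      by (intro prod_mono) (auto simp: add.commute[of _ 1])
    also have "\<dots> = exp (\<Sum>k<n. ?a k)"
      by (simp add: exp_sum)
    also have "(\<Sum>k<n. ?a k) \<le> pi\<^sup>2 / 6"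
    proof -
      have "?a sums (pi\<^sup>2 / 6)"
        using inverse_squares_sums by (simp add: add.commute)
      then show ?thesis
        by (metis (no_types, lifting) sum_le_suminf finite_lessThan sums_unique sums_summable
            divide_nonneg_nonneg zero_le_one zero_le_power2)
    qed
    finally show ?thesis by simp
  qed
  then show ?thesis
    by (intro nonneg_bdd_above_summable_on bdd_aboveI2[where M="exp (pi\<^sup>2 / 6)"]) auto
qed

section \<open>Bernoulli space and orthonormality of the \<open>Z \<theta> \<sigma>\<close>\<close>

locale bernoulli_space =
  fixes \<theta> :: "nat \<Rightarrow> real"
  assumes theta_pos: "\<And>n. 0 < \<theta> n" and theta_less_1: "\<And>n. \<theta> n < 1"
begin

sublocale M: prob_space "bernoulli_measure \<theta>"
  using theta_pos theta_less_1 by (rule prob_space_bernoulli_measure)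

lemmas indep_zeta = indep_vars_zeta[of \<theta>, OF theta_pos theta_less_1]

lemma zeta_measurable [measurable]: "zeta n \<in> borel_measurable (bernoulli_measure \<theta>)"
  using indep_zeta by (auto simp: M.indep_vars_def)

lemma Zn_measurable [measurable]: "Zn \<theta> n \<in> borel_measurable (bernoulli_measure \<theta>)"
  unfolding Zn_def[abs_def] by measurable

lemma Z_measurable [measurable]: "Z \<theta> \<sigma> \<in> borel_measurable (bernoulli_measure \<theta>)"
  unfolding Z_def[abs_def] by measurable

text \<open>A coordinate takes only the values 1 and -1 on the sample space, so
  \<open>f (zeta n \<omega>)\<close> is a combination of two indicators there. This is why
  \<open>f\<close> can be arbitrary.\<close>

lemma
  fixes f :: "real \<Rightarrow> real"
  shows integrable_zeta: "integrable (bernoulli_measure \<theta>) (\<lambda>\<omega>. f (zeta n \<omega>))"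
    and expectation_zeta: "M.expectation (\<lambda>\<omega>. f (zeta n \<omega>)) = \<theta> n * f 1 + (1 - \<theta> n) * f (- 1)"
proof -
  let ?A = "\<lambda>x. {\<omega> \<in> space (bernoulli_measure \<theta>). zeta n \<omega> = x}"
  let ?g = "\<lambda>\<omega>. indicator (?A 1) \<omega> * f 1 + indicator (?A (- 1)) \<omega> * f (- 1)"
  have sets [measurable]: "?A x \<in> sets (bernoulli_measure \<theta>)" for x
    by measurable
  have eq: "f (zeta n \<omega>) = ?g \<omega>" if "\<omega> \<in> space (bernoulli_measure \<theta>)" for \<omega>
  proof -
    have "zeta n \<omega> = 1 \<or> zeta n \<omega> = - 1"
      using that by (auto simp: space_bernoulli_measure zeta_def)
    then show ?thesis using that by auto
  qed
  have int: "integrable (bernoulli_measure \<theta>) ?g"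
    by (intro Bochner_Integration.integrable_add integrable_mult_left) (auto simp: M.emeasure_eq_measure)
  then show "integrable (bernoulli_measure \<theta>) (\<lambda>\<omega>. f (zeta n \<omega>))"
    using eq by (simp cong: Bochner_Integration.integrable_cong)
  have "M.expectation (\<lambda>\<omega>. f (zeta n \<omega>)) = M.expectation ?g"
    using eq by (intro Bochner_Integration.integral_cong) auto
  also have "\<dots> = M.prob (?A 1) * f 1 + M.prob (?A (- 1)) * f (- 1)"
    by (subst Bochner_Integration.integral_add)
      (auto simp: M.emeasure_eq_measure intro!: integrable_mult_left)
  also have "\<dots> = \<theta> n * f 1 + (1 - \<theta> n) * f (- 1)"
    using measure_zeta_1[of \<theta>, OF theta_pos theta_less_1] measure_zeta_neg1[of \<theta>, OF theta_pos theta_less_1]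
    by simp
  finally show "M.expectation (\<lambda>\<omega>. f (zeta n \<omega>)) = \<theta> n * f 1 + (1 - \<theta> n) * f (- 1)" .
qed

lemma expectation_Zn: "M.expectation (Zn \<theta> n) = 0"
  unfolding Zn_def[abs_def]
  by (subst expectation_zeta[of "\<lambda>x. (x + 1 - 2 * \<theta> n) / (2 * sqrt (\<theta> n * (1 - \<theta> n)))"])
    (simp add: algebra_simps add_divide_distrib diff_divide_distrib)

lemma expectation_Zn_square: "M.expectation (\<lambda>\<omega>. Zn \<theta> n \<omega> * Zn \<theta> n \<omega>) = 1"
proof -
  let ?s = "\<theta> n * (1 - \<theta> n)"
  have s: "0 < ?s" using theta_pos theta_less_1 by simp
  have "M.expectation (\<lambda>\<omega>. Zn \<theta> n \<omega> * Zn \<theta> n \<omega>)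
      = M.expectation (\<lambda>\<omega>. (zeta n \<omega> + 1 - 2 * \<theta> n)\<^sup>2 / (4 * ?s))"
    using s by (simp add: Zn_def power2_eq_square)
  also have "\<dots> = \<theta> n * ((2 - 2 * \<theta> n)\<^sup>2 / (4 * ?s)) + (1 - \<theta> n) * ((2 * \<theta> n)\<^sup>2 / (4 * ?s))"
    by (subst expectation_zeta[of "\<lambda>x. (x + 1 - 2 * \<theta> n)\<^sup>2 / (4 * ?s)"]) simp
  also have "\<dots> = (\<theta> n * (2 - 2 * \<theta> n)\<^sup>2 + (1 - \<theta> n) * (2 * \<theta> n)\<^sup>2) / (4 * ?s)"
    by (simp add: add_divide_distrib)
  also have "\<theta> n * (2 - 2 * \<theta> n)\<^sup>2 + (1 - \<theta> n) * (2 * \<theta> n)\<^sup>2 = 4 * ?s"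
    by algebra
  finally show ?thesis using theta_pos[of n] theta_less_1[of n] by simp
qed

text \<open>By independence the expectation of the product factors over the coordinates in
  \<open>\<sigma> \<union> \<tau>\<close>. A coordinate in both sets contributes the variance 1; one
  in the symmetric difference contributes the mean 0 and kills the product.\<close>

lemma Z_orthonormal:
  assumes "\<sigma> \<in> Gam" "\<tau> \<in> Gam"
  shows "L2_inner \<theta> (Z \<theta> \<sigma>) (Z \<theta> \<tau>) = (if \<sigma> = \<tau> then 1 else 0)"
proof -
  have fin: "finite \<sigma>" "finite \<tau>" using assms by (auto simp: Gam_def)
  \<comment> \<open>The default 1 outside \<open>\<sigma>\<close> or \<open>\<tau>\<close> lets both
    products run over the common index set \<open>\<sigma> \<union> \<tau>\<close>, with each factor
    a function of a single coordinate.\<close>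
  define h :: "nat \<Rightarrow> real \<Rightarrow> real" where
    "h n x = (if n \<in> \<sigma> then (x + 1 - 2 * \<theta> n) / (2 * sqrt (\<theta> n * (1 - \<theta> n))) else 1) *
             (if n \<in> \<tau> then (x + 1 - 2 * \<theta> n) / (2 * sqrt (\<theta> n * (1 - \<theta> n))) else 1)" for n x
  have h_zeta: "h n (zeta n \<omega>) = (if n \<in> \<sigma> then Zn \<theta> n \<omega> else 1) * (if n \<in> \<tau> then Zn \<theta> n \<omega> else 1)"
    for n \<omega> by (simp add: h_def Zn_def)
  have indep: "M.indep_vars (\<lambda>_. borel) (\<lambda>n \<omega>. h n (zeta n \<omega>)) (\<sigma> \<union> \<tau>)"
    by (rule M.indep_vars_subset[OF M.indep_vars_compose2[OF indep_zeta]])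
      (auto simp: h_def[abs_def])
  have "(\<Prod>i\<in>\<sigma>. Zn \<theta> i \<omega>) * (\<Prod>i\<in>\<tau>. Zn \<theta> i \<omega>) = (\<Prod>n\<in>\<sigma> \<union> \<tau>. h n (zeta n \<omega>))" for \<omega>
    using fin by (simp add: h_zeta prod.distrib prod.If_cases Int_absorb1 Int_absorb2 Int_Un_distrib Int_commute flip: prod.inter_restrict)
  then have "L2_inner \<theta> (Z \<theta> \<sigma>) (Z \<theta> \<tau>) =
      complex_of_real (M.expectation (\<lambda>\<omega>. \<Prod>n\<in>\<sigma> \<union> \<tau>. h n (zeta n \<omega>)))"
    unfolding L2_inner_def Z_def by (simp only: complex_cnj_complex_of_real of_real_mult[symmetric] integral_complex_of_real)
  also have "M.expectation (\<lambda>\<omega>. \<Prod>n\<in>\<sigma> \<union> \<tau>. h n (zeta n \<omega>))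
      = (\<Prod>n\<in>\<sigma> \<union> \<tau>. M.expectation (\<lambda>\<omega>. h n (zeta n \<omega>)))"
    using fin integrable_zeta indep by (intro M.indep_vars_lebesgue_integral) auto
  also have "\<dots> = (if \<sigma> = \<tau> then 1 else 0)"
  proof (cases "\<sigma> = \<tau>")
    case True
    then show ?thesis by (simp add: h_zeta expectation_Zn_square)
  next
    case False
    then obtain n where n: "n \<in> \<sigma> \<union> \<tau>" "n \<notin> \<sigma> \<or> n \<notin> \<tau>" by auto
    then have "M.expectation (\<lambda>\<omega>. h n (zeta n \<omega>)) = 0"
      by (auto simp: h_zeta expectation_Zn)
    then show ?thesis using n fin False by (auto intro!: prod_zero)
  qed
  finally show ?thesis by simp
qed

text \<open>Each of the finitely many factors is bounded because coordinates are 1 or -1.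
  Boundedness reduces the integrability of
  \<open>cnj (Z \<theta> \<sigma> \<omega>) * \<xi> \<omega>\<close> to that of
  \<open>\<xi>\<close>.\<close>

lemma Z_bounded: "\<exists>C. \<forall>\<omega>\<in>space (bernoulli_measure \<theta>). cmod (Z \<theta> \<sigma> \<omega>) \<le> C"
proof -
  let ?C = "\<lambda>i. (2 + 2 * \<bar>\<theta> i\<bar>) / \<bar>2 * sqrt (\<theta> i * (1 - \<theta> i))\<bar>"
  have "cmod (Z \<theta> \<sigma> \<omega>) \<le> (\<Prod>i\<in>\<sigma>. ?C i)" if "\<omega> \<in> space (bernoulli_measure \<theta>)" for \<omega>
  proof -
    have "\<bar>Zn \<theta> i \<omega>\<bar> \<le> ?C i" for i
    proof -
      have "\<omega> i = 1 \<or> \<omega> i = - 1" using that by (auto simp: space_bernoulli_measure)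
      then have "\<bar>zeta i \<omega> + 1 - 2 * \<theta> i\<bar> \<le> 2 + 2 * \<bar>\<theta> i\<bar>" by (auto simp: zeta_def)
      then show ?thesis unfolding Zn_def abs_divide by (intro divide_right_mono) auto
    qed
    then show ?thesis unfolding Z_def by (auto simp: abs_prod norm_of_real simp del: of_real_prod intro!: prod_mono)
  qed
  then show ?thesis by blast
qed

section \<open>Square-integrable functions: integrability and linear combinations\<close>

lemma L2_integrable:
  assumes "\<xi> \<in> L2 \<theta>" shows "integrable (bernoulli_measure \<theta>) \<xi>"
proof -
  \<comment> \<open>The constant 1 is integrable on a probability space, and
    \<open>1 + x\<^sup>2\<close> dominates \<open>x\<close>.\<close>
  have "integrable (bernoulli_measure \<theta>) (\<lambda>\<omega>. 1 + (cmod (\<xi> \<omega>))\<^sup>2)"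
    using assms by (auto simp: L2_def)
  then show ?thesis
  proof (rule Bochner_Integration.integrable_bound)
    show "\<xi> \<in> borel_measurable (bernoulli_measure \<theta>)" using assms by (simp add: L2_def)
    have "x \<le> 1 + x\<^sup>2" for x :: real
    proof -
      have "0 \<le> x\<^sup>2 + 1 - 2 * x"
        using zero_le_power2[of "x - 1"] by (simp add: power2_diff)
      then show ?thesis using zero_le_power2[of x] by linarith
    qed
    then show "AE \<omega> in bernoulli_measure \<theta>. norm (\<xi> \<omega>) \<le> norm (1 + (cmod (\<xi> \<omega>))\<^sup>2)"
      by auto
  qed
qed

lemma Z_mult_integrable:
  assumes "\<xi> \<in> L2 \<theta>"
  shows "integrable (bernoulli_measure \<theta>) (\<lambda>\<omega>. cnj (Z \<theta> \<sigma> \<omega>) * \<xi> \<omega>)"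
proof -
  obtain C where C: "\<And>\<omega>. \<omega> \<in> space (bernoulli_measure \<theta>) \<Longrightarrow> cmod (Z \<theta> \<sigma> \<omega>) \<le> C"
    using Z_bounded by blast
  have [measurable]: "\<xi> \<in> borel_measurable (bernoulli_measure \<theta>)"
    using assms by (simp add: L2_def)
  have "integrable (bernoulli_measure \<theta>) (\<lambda>\<omega>. complex_of_real C * \<xi> \<omega>)"
    using L2_integrable[OF assms] by simp
  then show ?thesis
  proof (rule Bochner_Integration.integrable_bound)
    show "AE \<omega> in bernoulli_measure \<theta>.
        norm (cnj (Z \<theta> \<sigma> \<omega>) * \<xi> \<omega>) \<le> norm (complex_of_real C * \<xi> \<omega>)"
    proof (rule AE_I2)
      fix \<omega> assume "\<omega> \<in> space (bernoulli_measure \<theta>)"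
      then have "cmod (Z \<theta> \<sigma> \<omega>) \<le> \<bar>C\<bar>" using C by fastforce
      then show "norm (cnj (Z \<theta> \<sigma> \<omega>) * \<xi> \<omega>) \<le> norm (complex_of_real C * \<xi> \<omega>)"
        by (simp add: norm_mult mult_right_mono)
    qed
  qed (simp add: Z_def, measurable)
qed

lemma L2_inner_lincomb:
  assumes "\<xi> \<in> L2 \<theta>" "\<eta> \<in> L2 \<theta>"
  shows "L2_inner \<theta> (Z \<theta> \<sigma>) (\<lambda>\<omega>. a * \<xi> \<omega> + b * \<eta> \<omega>)
    = a * L2_inner \<theta> (Z \<theta> \<sigma>) \<xi> + b * L2_inner \<theta> (Z \<theta> \<sigma>) \<eta>"
  unfolding L2_inner_def using Z_mult_integrable[OF assms(1), of \<sigma>] Z_mult_integrable[OF assms(2), of \<sigma>]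
  by (simp add: algebra_simps)

lemma L2_lincomb:
  assumes "\<xi> \<in> L2 \<theta>" "\<eta> \<in> L2 \<theta>"
  shows "(\<lambda>\<omega>. a * \<xi> \<omega> + b * \<eta> \<omega>) \<in> L2 \<theta>"
proof -
  have [measurable]: "\<xi> \<in> borel_measurable (bernoulli_measure \<theta>)"
      "\<eta> \<in> borel_measurable (bernoulli_measure \<theta>)"
    using assms by (auto simp: L2_def)
  have "integrable (bernoulli_measure \<theta>)
      (\<lambda>\<omega>. 2 * (cmod a)\<^sup>2 * (cmod (\<xi> \<omega>))\<^sup>2 + 2 * (cmod b)\<^sup>2 * (cmod (\<eta> \<omega>))\<^sup>2)"
    using assms by (auto simp: L2_def)
  then have "integrable (bernoulli_measure \<theta>) (\<lambda>\<omega>. (cmod (a * \<xi> \<omega> + b * \<eta> \<omega>))\<^sup>2)"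
  proof (rule Bochner_Integration.integrable_bound)
    have "(cmod (x + y))\<^sup>2 \<le> 2 * (cmod x)\<^sup>2 + 2 * (cmod y)\<^sup>2" for x y
    proof -
      have "(cmod (x + y))\<^sup>2 \<le> (cmod x + cmod y)\<^sup>2"
        by (intro power_mono norm_triangle_ineq) auto
      also have "\<dots> \<le> 2 * (cmod x)\<^sup>2 + 2 * (cmod y)\<^sup>2"
        using zero_le_power2[of "cmod x - cmod y"] by (simp add: power2_sum power2_diff)
      finally show ?thesis .
    qed
    from this[of "a * \<xi> _" "b * \<eta> _"]
    show "AE \<omega> in bernoulli_measure \<theta>. norm ((cmod (a * \<xi> \<omega> + b * \<eta> \<omega>))\<^sup>2)
        \<le> norm (2 * (cmod a)\<^sup>2 * (cmod (\<xi> \<omega>))\<^sup>2 + 2 * (cmod b)\<^sup>2 * (cmod (\<eta> \<omega>))\<^sup>2)"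
      by (auto simp: norm_mult power_mult_distrib mult.assoc)
  qed measurable
  then show ?thesis by (simp add: L2_def)
qed

lemma Z_in_L2: "Z \<theta> \<sigma> \<in> L2 \<theta>"
proof -
  obtain C where C: "\<And>\<omega>. \<omega> \<in> space (bernoulli_measure \<theta>) \<Longrightarrow> cmod (Z \<theta> \<sigma> \<omega>) \<le> C"
    using Z_bounded by blast
  have "integrable (bernoulli_measure \<theta>) (\<lambda>\<omega>. (cmod (Z \<theta> \<sigma> \<omega>))\<^sup>2)"
    by (rule M.integrable_const_bound[where B="C\<^sup>2"]) (auto intro!: AE_I2 power_mono C)
  then show ?thesis by (simp add: L2_def)
qed

section \<open>Weighted coefficients and the norms on the testing functionals\<close>

abbreviation coef :: "rv \<Rightarrow> nat set \<Rightarrow> complex" where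
  "coef \<xi> \<sigma> \<equiv> L2_inner \<theta> (Z \<theta> \<sigma>) \<xi>"

text \<open>With the weight moved inside the square, \<open>S_norm \<theta> p \<xi>\<close> is the
  plain l2 norm of \<open>wcoef p \<xi>\<close>, so the l2 inequalities apply directly.\<close>

definition wcoef :: "real \<Rightarrow> rv \<Rightarrow> nat set \<Rightarrow> real" where
  "wcoef p \<xi> \<sigma> = lam \<sigma> powr p * cmod (coef \<xi> \<sigma>)"

lemma wcoef_nonneg: "0 \<le> wcoef p \<xi> \<sigma>"
  by (simp add: wcoef_def)

lemma S_norm_eq: "S_norm \<theta> p \<xi> = sqrt (\<Sum>\<^sub>\<infinity>\<sigma>\<in>Gam. (wcoef p \<xi> \<sigma>)\<^sup>2)"
  by (simp add: S_norm_def lam_powr_square wcoef_def)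

lemma S_iff: "\<xi> \<in> S \<theta> \<longleftrightarrow> \<xi> \<in> L2 \<theta> \<and> (\<forall>p\<ge>0. (\<lambda>\<sigma>. (wcoef p \<xi> \<sigma>)\<^sup>2) summable_on Gam)"
  by (auto simp: S_def S_space_def lam_powr_square wcoef_def)

lemma S_L2: "\<xi> \<in> S \<theta> \<Longrightarrow> \<xi> \<in> L2 \<theta>"
  by (simp add: S_iff)

lemma wcoef_summable: "\<xi> \<in> S \<theta> \<Longrightarrow> 0 \<le> p \<Longrightarrow> (\<lambda>\<sigma>. (wcoef p \<xi> \<sigma>)\<^sup>2) summable_on Gam"
  by (simp add: S_iff)

lemma S_norm_nonneg: "0 \<le> S_norm \<theta> p \<xi>"
  by (simp add: S_norm_eq infsum_nonneg)

text \<open>All weights are at least 1. The norms therefore form a directed family: finitely many of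
  them are dominated by a single one.\<close>

lemma S_norm_mono:
  assumes "\<xi> \<in> S \<theta>" "0 \<le> p" "p \<le> q"
  shows "S_norm \<theta> p \<xi> \<le> S_norm \<theta> q \<xi>"
  unfolding S_norm_eq using assms
  by (intro real_sqrt_le_mono infsum_mono wcoef_summable power_mono wcoef_nonneg)
    (auto simp: wcoef_def intro!: mult_right_mono lam_powr_mono)

lemma coef_lincomb:
  assumes "\<xi> \<in> S \<theta>" "\<eta> \<in> S \<theta>"
  shows "coef (\<lambda>\<omega>. a * \<xi> \<omega> + b * \<eta> \<omega>) \<sigma> = a * coef \<xi> \<sigma> + b * coef \<eta> \<sigma>"
  using assms by (intro L2_inner_lincomb S_L2)

lemma wcoef_lincomb_le:
  assumes "\<xi> \<in> S \<theta>" "\<eta> \<in> S \<theta>"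
  shows "wcoef p (\<lambda>\<omega>. a * \<xi> \<omega> + b * \<eta> \<omega>) \<sigma> \<le> cmod a * wcoef p \<xi> \<sigma> + cmod b * wcoef p \<eta> \<sigma>"
proof -
  have "cmod (coef (\<lambda>\<omega>. a * \<xi> \<omega> + b * \<eta> \<omega>) \<sigma>) \<le> cmod a * cmod (coef \<xi> \<sigma>) + cmod b * cmod (coef \<eta> \<sigma>)"
    using norm_triangle_ineq[of "a * coef \<xi> \<sigma>" "b * coef \<eta> \<sigma>"] by (simp add: coef_lincomb assms norm_mult)
  then have "wcoef p (\<lambda>\<omega>. a * \<xi> \<omega> + b * \<eta> \<omega>) \<sigma> \<le>
      lam \<sigma> powr p * (cmod a * cmod (coef \<xi> \<sigma>) + cmod b * cmod (coef \<eta> \<sigma>))"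
    unfolding wcoef_def by (intro mult_left_mono) auto
  then show ?thesis by (simp add: wcoef_def algebra_simps)
qed

text \<open>Coefficients depend linearly on the vector, so the weighted coefficients of the
  combination are dominated termwise by a sum of two l2 families, to which Minkowski's inequality
  applies.\<close>

lemma
  assumes \<xi>: "\<xi> \<in> S \<theta>" and \<eta>: "\<eta> \<in> S \<theta>"
  shows S_lincomb: "(\<lambda>\<omega>. a * \<xi> \<omega> + b * \<eta> \<omega>) \<in> S \<theta>"
    and S_norm_lincomb: "0 \<le> p \<Longrightarrow> S_norm \<theta> p (\<lambda>\<omega>. a * \<xi> \<omega> + b * \<eta> \<omega>)
      \<le> cmod a * S_norm \<theta> p \<xi> + cmod b * S_norm \<theta> p \<eta>"
proof -
  let ?u = "\<lambda>\<omega>. a * \<xi> \<omega> + b * \<eta> \<omega>"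
  let ?f = "\<lambda>p \<sigma>. cmod a * wcoef p \<xi> \<sigma>" and ?g = "\<lambda>p \<sigma>. cmod b * wcoef p \<eta> \<sigma>"
  have f: "(\<lambda>\<sigma>. (?f p \<sigma>)\<^sup>2) summable_on Gam" and g: "(\<lambda>\<sigma>. (?g p \<sigma>)\<^sup>2) summable_on Gam"
    if "0 \<le> p" for p
    using that \<xi> \<eta> by (auto simp: power_mult_distrib intro!: summable_on_cmult_right wcoef_summable)
  have le: "(wcoef p ?u \<sigma>)\<^sup>2 \<le> (?f p \<sigma> + ?g p \<sigma>)\<^sup>2" for p \<sigma>
    using \<xi> \<eta> by (intro power_mono wcoef_nonneg wcoef_lincomb_le)
  have u: "(\<lambda>\<sigma>. (wcoef p ?u \<sigma>)\<^sup>2) summable_on Gam" if "0 \<le> p" for p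
    using l2_add_summable[OF f[OF that] g[OF that]] le
    by (rule summable_on_comparison_test) simp
  then show "?u \<in> S \<theta>"
    using \<xi> \<eta> by (auto simp: S_iff L2_lincomb)
  assume p: "0 \<le> p"
  have "S_norm \<theta> p ?u \<le> sqrt (\<Sum>\<^sub>\<infinity>\<sigma>\<in>Gam. (?f p \<sigma> + ?g p \<sigma>)\<^sup>2)"
    unfolding S_norm_eq using p l2_add_summable[OF f g] u le
    by (intro real_sqrt_le_mono infsum_mono) auto
  also have "\<dots> \<le> sqrt (\<Sum>\<^sub>\<infinity>\<sigma>\<in>Gam. (?f p \<sigma>)\<^sup>2) + sqrt (\<Sum>\<^sub>\<infinity>\<sigma>\<in>Gam. (?g p \<sigma>)\<^sup>2)"
    using p by (intro l2_triangle f g)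
  finally show "S_norm \<theta> p ?u \<le> cmod a * S_norm \<theta> p \<xi> + cmod b * S_norm \<theta> p \<eta>"
    by (simp add: l2_scale S_norm_eq)
qed

lemma S_diff: "\<xi> \<in> S \<theta> \<Longrightarrow> \<eta> \<in> S \<theta> \<Longrightarrow> (\<lambda>\<omega>. \<xi> \<omega> - \<eta> \<omega>) \<in> S \<theta>"
  using S_lincomb[of \<xi> \<eta> 1 "- 1"] by simp

lemma coef_diff: "\<xi> \<in> S \<theta> \<Longrightarrow> \<eta> \<in> S \<theta> \<Longrightarrow> coef (\<lambda>\<omega>. \<xi> \<omega> - \<eta> \<omega>) \<sigma> = coef \<xi> \<sigma> - coef \<eta> \<sigma>"
  using coef_lincomb[of \<xi> \<eta> \<sigma> 1 "- 1"] by simp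

lemma S_scale: "\<xi> \<in> S \<theta> \<Longrightarrow> (\<lambda>\<omega>. a * \<xi> \<omega>) \<in> S \<theta>"
  using S_lincomb[of \<xi> \<xi> a 0] by simp

lemma S_norm_scale_le: "\<xi> \<in> S \<theta> \<Longrightarrow> 0 \<le> p \<Longrightarrow> S_norm \<theta> p (\<lambda>\<omega>. a * \<xi> \<omega>) \<le> cmod a * S_norm \<theta> p \<xi>"
  using S_norm_lincomb[of \<xi> \<xi> p a 0] by simp

lemma S_norm_triangle:
  assumes "\<xi> \<in> S \<theta>" "\<eta> \<in> S \<theta>" "\<zeta> \<in> S \<theta>" "0 \<le> p"
  shows "S_norm \<theta> p (\<lambda>\<omega>. \<xi> \<omega> - \<zeta> \<omega>) \<le> S_norm \<theta> p (\<lambda>\<omega>. \<xi> \<omega> - \<eta> \<omega>) + S_norm \<theta> p (\<lambda>\<omega>. \<eta> \<omega> - \<zeta> \<omega>)"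
  using S_norm_lincomb[of "\<lambda>\<omega>. \<xi> \<omega> - \<eta> \<omega>" "\<lambda>\<omega>. \<eta> \<omega> - \<zeta> \<omega>" p 1 1] assms S_diff by simp

lemma Z_in_S:
  assumes "\<sigma> \<in> Gam" shows "Z \<theta> \<sigma> \<in> S \<theta>"
proof -
  \<comment> \<open>By orthonormality only the term at \<open>\<sigma>\<close> survives.\<close>
  have "((\<lambda>\<tau>. (wcoef p (Z \<theta> \<sigma>) \<tau>)\<^sup>2) has_sum (\<Sum>\<tau>\<in>{\<sigma>}. (wcoef p (Z \<theta> \<sigma>) \<tau>)\<^sup>2)) Gam" for p
    using assms by (intro has_sum_finite_neutralI[where B="{\<sigma>}"]) (auto simp: wcoef_def Z_orthonormal)
  then show ?thesis
    unfolding S_iff using Z_in_L2 by (auto simp: summable_on_def)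
qed

lemma zero_in_S: "(\<lambda>_. 0) \<in> S \<theta>"
  using S_scale[OF Z_in_S, of "{}" 0] by (simp add: Gam_def)

lemma S_norm_zero: "0 \<le> p \<Longrightarrow> S_norm \<theta> p (\<lambda>_. 0) = 0"
  using S_norm_scale_le[OF zero_in_S, of p 0] S_norm_nonneg[of p "\<lambda>_. 0"] by simp

subsection \<open>The topology of the testing functionals\<close>

abbreviation S_ball :: "real \<Rightarrow> rv \<Rightarrow> real \<Rightarrow> rv set" where
  "S_ball p \<xi> r \<equiv> {\<eta> \<in> S \<theta>. S_norm \<theta> p (\<lambda>\<omega>. \<eta> \<omega> - \<xi> \<omega>) < r}"

lemma openin_S_ball:
  "\<xi> \<in> S \<theta> \<Longrightarrow> 0 \<le> p \<Longrightarrow> 0 < r \<Longrightarrow> openin (S_topology \<theta>) (S_ball p \<xi> r)"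
  unfolding S_topology_def by (rule topology_generated_by_Basis) blast

lemma centre_in_S_ball: "\<xi> \<in> S \<theta> \<Longrightarrow> 0 \<le> p \<Longrightarrow> 0 < r \<Longrightarrow> \<xi> \<in> S_ball p \<xi> r"
  by (simp add: S_norm_zero)

lemma topspace_S [simp]: "topspace (S_topology \<theta>) = S \<theta>"
proof
  show "topspace (S_topology \<theta>) \<subseteq> S \<theta>"
    unfolding S_topology_def by auto
  show "S \<theta> \<subseteq> topspace (S_topology \<theta>)"
    using openin_subset[OF openin_S_ball[of _ 0 1]] centre_in_S_ball[of _ 0 1] by fastforce
qed

text \<open>The balls are given only as a subbasis. Directedness of the norms makes the balls
  centred at a point, each for a single norm, a neighbourhood base; the forward direction is an
  induction over the generation of the topology.\<close>

lemma openin_S_iff: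
  "openin (S_topology \<theta>) U \<longleftrightarrow> U \<subseteq> S \<theta> \<and> (\<forall>\<xi>\<in>U. \<exists>p\<ge>0. \<exists>r>0. S_ball p \<xi> r \<subseteq> U)"
    (is "_ \<longleftrightarrow> ?R U")
proof
  assume "openin (S_topology \<theta>) U"
  then have "generate_topology_on {S_ball p \<xi> r | \<xi> p r. \<xi> \<in> S \<theta> \<and> 0 \<le> p \<and> 0 < r} U"
    unfolding S_topology_def openin_topology_generated_by_iff .
  then show "?R U"
  proof induction
    case Empty
    then show ?case by simp
  next
    case (Int a b)
    have "\<exists>p\<ge>0. \<exists>r>0. S_ball p \<xi> r \<subseteq> a \<inter> b" if \<xi>: "\<xi> \<in> a \<inter> b" for \<xi>
    proof -
      have "\<xi> \<in> S \<theta>" using \<xi> Int.IH by auto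
      obtain p r where pr: "0 \<le> p" "0 < r" "S_ball p \<xi> r \<subseteq> a"
        using \<xi> Int.IH by auto
      obtain q s where qs: "0 \<le> q" "0 < s" "S_ball q \<xi> s \<subseteq> b"
        using \<xi> Int.IH by auto
      \<comment> \<open>The norm of index \<open>max p q\<close> dominates both norms, so one ball
        fits into the intersection.\<close>
      have "\<eta> \<in> S_ball p \<xi> r \<inter> S_ball q \<xi> s" if "\<eta> \<in> S_ball (max p q) \<xi> (min r s)" for \<eta>
        using that S_norm_mono[of "\<lambda>\<omega>. \<eta> \<omega> - \<xi> \<omega>" p "max p q"]
          S_norm_mono[of "\<lambda>\<omega>. \<eta> \<omega> - \<xi> \<omega>" q "max p q"] S_diff[of \<eta> \<xi>] \<open>\<xi> \<in> S \<theta>\<close> pr qs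
        by auto
      then have "S_ball (max p q) \<xi> (min r s) \<subseteq> a \<inter> b"
        using pr(3) qs(3) by (meson IntD1 IntD2 IntI subsetD subsetI)
      then show ?thesis
        using pr qs by (intro exI[of _ "max p q"] conjI exI[of _ "min r s"]) simp_all
    qed
    then show ?case using Int.IH by blast
  next
    case (UN K)
    show ?case
    proof (intro conjI ballI)
      show "\<Union>K \<subseteq> S \<theta>" using UN.IH by (intro Union_least) simp
      fix \<xi> assume "\<xi> \<in> \<Union>K"
      then obtain k where k: "k \<in> K" "\<xi> \<in> k" by (rule UnionE)
      then obtain p r where "0 \<le> p" "0 < r" "S_ball p \<xi> r \<subseteq> k"
        using UN.IH by meson
      then show "\<exists>p\<ge>0. \<exists>r>0. S_ball p \<xi> r \<subseteq> \<Union>K"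
        using k(1) by (meson Union_upper order_trans)
    qed
  next
    case (Basis s)
    then obtain \<zeta> p r where \<zeta>: "\<zeta> \<in> S \<theta>" "0 \<le> p" "s = S_ball p \<zeta> r" by auto
    \<comment> \<open>A ball is recentred at \<open>\<xi>\<close> with the radius left over after
      the distance from \<open>\<zeta>\<close> to \<open>\<xi>\<close>.\<close>
    have "S_ball p \<xi> (r - S_norm \<theta> p (\<lambda>\<omega>. \<xi> \<omega> - \<zeta> \<omega>)) \<subseteq> s" if "\<xi> \<in> s" for \<xi>
      using S_norm_triangle[of _ \<xi> \<zeta> p] that \<zeta> by fastforce
    moreover have "r - S_norm \<theta> p (\<lambda>\<omega>. \<xi> \<omega> - \<zeta> \<omega>) > 0" if "\<xi> \<in> s" for \<xi>
      using that \<zeta> by auto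
    ultimately show ?case using \<zeta> by blast
  qed
next
  assume R: "?R U"
  show "openin (S_topology \<theta>) U"
  proof (subst openin_subopen, intro ballI)
    fix \<xi> assume "\<xi> \<in> U"
    with R obtain p r where "\<xi> \<in> S \<theta>" "0 \<le> p" "0 < r" "S_ball p \<xi> r \<subseteq> U" by blast
    then show "\<exists>T. openin (S_topology \<theta>) T \<and> \<xi> \<in> T \<and> T \<subseteq> U"
      by (intro exI[of _ "S_ball p \<xi> r"] conjI openin_S_ball centre_in_S_ball)
  qed
qed

lemma openin_S_E:
  assumes U: "openin (S_topology \<theta>) U" and \<xi>: "\<xi> \<in> U"
  obtains p r where "0 \<le> p" "0 < r" "S_ball p \<xi> r \<subseteq> U"
proof -
  have "\<exists>p\<ge>0. \<exists>r>0. S_ball p \<xi> r \<subseteq> U"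
    using conjunct2[OF iffD1[OF openin_S_iff U]] \<xi> by (rule bspec)
  then show ?thesis using that by (elim exE conjE)
qed

subsection \<open>Generalized functionals\<close>

lemma S_dual_lincomb_arg:
  "\<Phi> \<in> S_dual \<theta> \<Longrightarrow> \<xi> \<in> S \<theta> \<Longrightarrow> \<eta> \<in> S \<theta> \<Longrightarrow>
    \<Phi> (\<lambda>\<omega>. a * \<xi> \<omega> + b * \<eta> \<omega>) = a * \<Phi> \<xi> + b * \<Phi> \<eta>"
  by (simp add: S_dual_def)

lemma S_dual_outside: "\<Phi> \<in> S_dual \<theta> \<Longrightarrow> \<xi> \<notin> S \<theta> \<Longrightarrow> \<Phi> \<xi> = 0"
  by (simp add: S_dual_def)

lemma S_dual_scale_arg: "\<Phi> \<in> S_dual \<theta> \<Longrightarrow> \<xi> \<in> S \<theta> \<Longrightarrow> \<Phi> (\<lambda>\<omega>. a * \<xi> \<omega>) = a * \<Phi> \<xi>"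
  using S_dual_lincomb_arg[of \<Phi> \<xi> \<xi> a 0] by simp

lemma S_dual_zero_arg: "\<Phi> \<in> S_dual \<theta> \<Longrightarrow> \<Phi> (\<lambda>_. 0) = 0"
  using S_dual_scale_arg[OF _ zero_in_S, of \<Phi> 0] by simp

lemma S_dual_diff_arg:
  "\<Phi> \<in> S_dual \<theta> \<Longrightarrow> \<xi> \<in> S \<theta> \<Longrightarrow> \<eta> \<in> S \<theta> \<Longrightarrow> \<Phi> (\<lambda>\<omega>. \<xi> \<omega> - \<eta> \<omega>) = \<Phi> \<xi> - \<Phi> \<eta>"
  using S_dual_lincomb_arg[of \<Phi> \<xi> \<eta> 1 "- 1"] by simp

text \<open>Continuity at 0 sends some ball of radius \<open>r\<close> into the unit disc;
  homogeneity spreads this to a bound with constant \<open>1 / r\<close> on the whole space.\<close>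

lemma S_dual_bounded:
  assumes \<Phi>: "\<Phi> \<in> S_dual \<theta>"
  obtains C p where "0 \<le> C" "0 \<le> p" "\<And>\<xi>. \<xi> \<in> S \<theta> \<Longrightarrow> cmod (\<Phi> \<xi>) \<le> C * S_norm \<theta> p \<xi>"
proof -
  have "continuous_map (S_topology \<theta>) euclidean \<Phi>"
    using \<Phi> by (simp add: S_dual_def)
  then have "openin (S_topology \<theta>) {\<xi> \<in> topspace (S_topology \<theta>). \<Phi> \<xi> \<in> ball 0 1}"
    by (rule openin_continuous_map_preimage) simp
  moreover have "(\<lambda>_. 0) \<in> {\<xi> \<in> topspace (S_topology \<theta>). \<Phi> \<xi> \<in> ball 0 1}"
    using zero_in_S S_dual_zero_arg[OF \<Phi>] by simp
  ultimately obtain p r where p: "0 \<le> p" and r: "0 < r"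
    and sub: "S_ball p (\<lambda>_. 0) r \<subseteq> {\<xi> \<in> topspace (S_topology \<theta>). \<Phi> \<xi> \<in> ball 0 1}"
    by (rule openin_S_E)
  have "cmod (\<Phi> \<xi>) \<le> 1 / r * S_norm \<theta> p \<xi>" if \<xi>: "\<xi> \<in> S \<theta>" for \<xi>
  proof (rule field_le_epsilon)
    fix e :: real assume e: "0 < e"
    \<comment> \<open>The norm may be 0, so the scaling factor exceeds
      \<open>S_norm \<theta> p \<xi> / r\<close> by \<open>e\<close>; this makes it positive and
      puts the rescaled vector strictly inside the ball.\<close>
    define t where "t = 1 / r * S_norm \<theta> p \<xi> + e"
    have t: "0 < t" using e r S_norm_nonneg[of p \<xi>] by (simp add: t_def add_nonneg_pos)
    let ?\<eta> = "\<lambda>\<omega>. complex_of_real (1 / t) * \<xi> \<omega>"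
    have "S_norm \<theta> p ?\<eta> \<le> cmod (complex_of_real (1 / t)) * S_norm \<theta> p \<xi>"
      using \<xi> p by (rule S_norm_scale_le)
    also have "\<dots> = S_norm \<theta> p \<xi> / t"
      using t by (simp add: norm_divide)
    also have "\<dots> < r"
      using t e r by (simp add: divide_simps) (simp add: t_def algebra_simps)
    finally have "?\<eta> \<in> S_ball p (\<lambda>_. 0) r"
      using S_scale[OF \<xi>, of "complex_of_real (1 / t)"] by simp
    then have "cmod (\<Phi> ?\<eta>) < 1" using sub by auto
    moreover have "\<Phi> ?\<eta> = complex_of_real (1 / t) * \<Phi> \<xi>"
      using \<Phi> \<xi> by (rule S_dual_scale_arg)
    ultimately have "cmod (\<Phi> \<xi>) / t < 1"
      using t by (simp add: norm_mult norm_divide)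
    then show "cmod (\<Phi> \<xi>) \<le> 1 / r * S_norm \<theta> p \<xi> + e"
      using t by (simp add: t_def)
  qed
  then show ?thesis using that[of "1 / r" p] p r by simp
qed

text \<open>Converse of \<open>S_dual_bounded\<close>: a linear functional bounded by one norm is
  Lipschitz for it. The two lemmas together exchange continuity for a single estimate.\<close>

lemma bounded_S_dual:
  assumes outside: "\<And>\<xi>. \<xi> \<notin> S \<theta> \<Longrightarrow> \<Phi> \<xi> = 0"
    and lin: "\<And>\<xi> \<eta> a b. \<xi> \<in> S \<theta> \<Longrightarrow> \<eta> \<in> S \<theta> \<Longrightarrow>
      \<Phi> (\<lambda>\<omega>. a * \<xi> \<omega> + b * \<eta> \<omega>) = a * \<Phi> \<xi> + b * \<Phi> \<eta>"
    and p: "0 \<le> p" and bound: "\<And>\<xi>. \<xi> \<in> S \<theta> \<Longrightarrow> cmod (\<Phi> \<xi>) \<le> C * S_norm \<theta> p \<xi>"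
  shows "\<Phi> \<in> S_dual \<theta>"
proof -
  have "openin (S_topology \<theta>) {\<xi> \<in> S \<theta>. \<Phi> \<xi> \<in> V}" if V: "open V" for V
    unfolding openin_S_iff
  proof (intro conjI ballI)
    fix \<xi> assume "\<xi> \<in> {\<xi> \<in> S \<theta>. \<Phi> \<xi> \<in> V}"
    then obtain e where \<xi>: "\<xi> \<in> S \<theta>" and e: "0 < e" "ball (\<Phi> \<xi>) e \<subseteq> V"
      using V open_contains_ball by blast
    \<comment> \<open>\<open>\<bar>C\<bar> + 1\<close> is positive whatever the sign of
      \<open>C\<close>.\<close>
    have "dist (\<Phi> \<xi>) (\<Phi> \<eta>) < e" if "\<eta> \<in> S_ball p \<xi> (e / (\<bar>C\<bar> + 1))" for \<eta>
    proof -
      have \<eta>: "\<eta> \<in> S \<theta>" and less: "S_norm \<theta> p (\<lambda>\<omega>. \<eta> \<omega> - \<xi> \<omega>) < e / (\<bar>C\<bar> + 1)"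
        using that by auto
      have "dist (\<Phi> \<xi>) (\<Phi> \<eta>) = cmod (\<Phi> (\<lambda>\<omega>. \<eta> \<omega> - \<xi> \<omega>))"
        using lin[OF \<eta> \<xi>, of 1 "- 1"] by (simp add: dist_norm norm_minus_commute)
      also have "\<dots> \<le> C * S_norm \<theta> p (\<lambda>\<omega>. \<eta> \<omega> - \<xi> \<omega>)"
        using S_diff[OF \<eta> \<xi>] by (rule bound)
      also have "\<dots> \<le> (\<bar>C\<bar> + 1) * S_norm \<theta> p (\<lambda>\<omega>. \<eta> \<omega> - \<xi> \<omega>)"
        using S_norm_nonneg by (intro mult_right_mono) auto
      also have "\<dots> < e"
        using less by (simp add: pos_less_divide_eq mult.commute add_nonneg_pos)
      finally show ?thesis .
    qed
    then have "S_ball p \<xi> (e / (\<bar>C\<bar> + 1)) \<subseteq> {\<xi> \<in> S \<theta>. \<Phi> \<xi> \<in> V}"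
      using e by auto
    moreover have "0 < e / (\<bar>C\<bar> + 1)" using e by (simp add: add_nonneg_pos)
    ultimately show "\<exists>p\<ge>0. \<exists>r>0. S_ball p \<xi> r \<subseteq> {\<xi> \<in> S \<theta>. \<Phi> \<xi> \<in> V}"
      using p by blast
  qed auto
  then have "continuous_map (S_topology \<theta>) euclidean \<Phi>"
    by (simp add: continuous_map)
  then show ?thesis
    using outside lin by (simp add: S_dual_def)
qed

text \<open>The two norm bounds are brought to the common index \<open>max p q\<close> and
  added.\<close>

lemma S_dual_lincomb:
  assumes \<Phi>: "\<Phi> \<in> S_dual \<theta>" and \<Psi>: "\<Psi> \<in> S_dual \<theta>"
  shows "(\<lambda>\<xi>. a * \<Phi> \<xi> + b * \<Psi> \<xi>) \<in> S_dual \<theta>"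
proof -
  obtain C p where C: "0 \<le> C" "0 \<le> p" "\<And>\<xi>. \<xi> \<in> S \<theta> \<Longrightarrow> cmod (\<Phi> \<xi>) \<le> C * S_norm \<theta> p \<xi>"
    using S_dual_bounded[OF \<Phi>] by blast
  obtain D q where D: "0 \<le> D" "0 \<le> q" "\<And>\<xi>. \<xi> \<in> S \<theta> \<Longrightarrow> cmod (\<Psi> \<xi>) \<le> D * S_norm \<theta> q \<xi>"
    using S_dual_bounded[OF \<Psi>] by blast
  show ?thesis
  proof (rule bounded_S_dual)
    show "cmod (a * \<Phi> \<xi> + b * \<Psi> \<xi>) \<le> (cmod a * C + cmod b * D) * S_norm \<theta> (max p q) \<xi>"
      if \<xi>: "\<xi> \<in> S \<theta>" for \<xi>
    proof -
      have "cmod (\<Phi> \<xi>) \<le> C * S_norm \<theta> (max p q) \<xi>"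
        using C(3)[OF \<xi>] mult_left_mono[OF S_norm_mono[OF \<xi> C(2), of "max p q"] C(1)] by simp
      moreover have "cmod (\<Psi> \<xi>) \<le> D * S_norm \<theta> (max p q) \<xi>"
        using D(3)[OF \<xi>] mult_left_mono[OF S_norm_mono[OF \<xi> D(2), of "max p q"] D(1)] by simp
      ultimately have "cmod a * cmod (\<Phi> \<xi>) + cmod b * cmod (\<Psi> \<xi>)
          \<le> cmod a * (C * S_norm \<theta> (max p q) \<xi>) + cmod b * (D * S_norm \<theta> (max p q) \<xi>)"
        by (intro add_mono mult_left_mono) auto
      then show ?thesis
        using norm_triangle_ineq[of "a * \<Phi> \<xi>" "b * \<Psi> \<xi>"] by (simp add: norm_mult algebra_simps)
    qed
  qed (use \<Phi> \<Psi> C(2) in \<open>auto simp: S_dual_outside S_dual_lincomb_arg algebra_simps\<close>)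
qed

section \<open>Finite partial sums of the expansion in the \<open>Z \<theta> \<sigma>\<close>, and
  density\<close>

definition expansion :: "nat set set \<Rightarrow> rv \<Rightarrow> rv" where
  "expansion F \<xi> \<omega> = (\<Sum>\<sigma>\<in>F. coef \<xi> \<sigma> * Z \<theta> \<sigma> \<omega>)"

lemma expansion_empty: "expansion {} \<xi> = (\<lambda>_. 0)"
  by (simp add: expansion_def fun_eq_iff)

text \<open>The factor \<open>1 *\<close> gives the right-hand side the shape of the linearity
  lemmas, which the inductions below apply to it.\<close>

lemma expansion_insert:
  "finite F \<Longrightarrow> \<sigma> \<notin> F \<Longrightarrow>
    expansion (insert \<sigma> F) \<xi> = (\<lambda>\<omega>. coef \<xi> \<sigma> * Z \<theta> \<sigma> \<omega> + 1 * expansion F \<xi> \<omega>)"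
  by (simp add: expansion_def fun_eq_iff)

lemma expansion_in_S: "finite F \<Longrightarrow> F \<subseteq> Gam \<Longrightarrow> expansion F \<xi> \<in> S \<theta>"
proof (induction F rule: finite_induct)
  case empty
  then show ?case by (simp add: expansion_empty zero_in_S)
next
  case (insert \<sigma> F)
  then show ?case
    unfolding expansion_insert[OF insert.hyps] by (intro S_lincomb Z_in_S) auto
qed

lemma coef_expansion:
  "finite F \<Longrightarrow> F \<subseteq> Gam \<Longrightarrow> \<tau> \<in> Gam \<Longrightarrow>
    coef (expansion F \<xi>) \<tau> = (if \<tau> \<in> F then coef \<xi> \<tau> else 0)"
proof (induction F rule: finite_induct)
  case empty
  then show ?case by (simp add: expansion_empty L2_inner_def)
next
  case (insert \<sigma> F)
  then have "Z \<theta> \<sigma> \<in> S \<theta>" "expansion F \<xi> \<in> S \<theta>"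
    by (auto intro: Z_in_S expansion_in_S)
  then show ?case
    unfolding expansion_insert[OF insert.hyps] using insert
    by (subst coef_lincomb) (auto simp: Z_orthonormal)
qed

lemma S_dual_expansion:
  assumes \<Phi>: "\<Phi> \<in> S_dual \<theta>"
  shows "finite F \<Longrightarrow> F \<subseteq> Gam \<Longrightarrow> \<Phi> (expansion F \<xi>) = (\<Sum>\<sigma>\<in>F. coef \<xi> \<sigma> * \<Phi> (Z \<theta> \<sigma>))"
proof (induction F rule: finite_induct)
  case empty
  then show ?case by (simp add: expansion_empty S_dual_zero_arg \<Phi>)
next
  case (insert \<sigma> F)
  then have "Z \<theta> \<sigma> \<in> S \<theta>" "expansion F \<xi> \<in> S \<theta>"
    by (auto intro: Z_in_S expansion_in_S)
  then show ?case
    unfolding expansion_insert[OF insert.hyps] using insert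
    by (subst S_dual_lincomb_arg[OF \<Phi>]) auto
qed

text \<open>Subtracting a partial sum erases exactly the coefficients in \<open>F\<close>, so the
  squared norm of the remainder is the tail over \<open>Gam - F\<close> of a convergent
  series.\<close>

lemma expansion_approx:
  assumes \<xi>: "\<xi> \<in> S \<theta>" and p: "0 \<le> p" and e: "0 < e"
  obtains F where "finite F" "F \<subseteq> Gam" "S_norm \<theta> p (\<lambda>\<omega>. \<xi> \<omega> - expansion F \<xi> \<omega>) \<le> e"
proof -
  let ?w = "\<lambda>\<sigma>. (wcoef p \<xi> \<sigma>)\<^sup>2"
  have s: "?w summable_on Gam" using \<xi> p by (rule wcoef_summable)
  obtain F where F: "finite F" "F \<subseteq> Gam" and d: "dist (sum ?w F) (infsum ?w Gam) \<le> e\<^sup>2"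
    using infsum_finite_approximation[OF s, of "e\<^sup>2"] e by auto
  have "(\<Sum>\<^sub>\<infinity>\<sigma>\<in>Gam. (wcoef p (\<lambda>\<omega>. \<xi> \<omega> - expansion F \<xi> \<omega>) \<sigma>)\<^sup>2) = (\<Sum>\<^sub>\<infinity>\<sigma>\<in>Gam - F. ?w \<sigma>)"
    using F \<xi> by (intro infsum_cong_neutral)
      (auto simp: wcoef_def coef_diff expansion_in_S coef_expansion)
  also have "\<dots> = infsum ?w Gam - sum ?w F"
    using F s by (subst infsum_Diff) auto
  also have "\<dots> \<le> e\<^sup>2" using d by (simp add: dist_real_def)
  finally have "S_norm \<theta> p (\<lambda>\<omega>. \<xi> \<omega> - expansion F \<xi> \<omega>) \<le> e"
    unfolding S_norm_eq using e by (intro real_le_lsqrt) (auto intro!: infsum_nonneg)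
  then show ?thesis using that F by blast
qed

text \<open>The difference of the functionals is bounded by one norm and vanishes on all partial
  sums, which approximate \<open>\<xi>\<close> in that very norm.\<close>

lemma S_dual_eqI:
  assumes \<Phi>: "\<Phi> \<in> S_dual \<theta>" and \<Psi>: "\<Psi> \<in> S_dual \<theta>"
    and eq: "\<And>\<sigma>. \<sigma> \<in> Gam \<Longrightarrow> \<Phi> (Z \<theta> \<sigma>) = \<Psi> (Z \<theta> \<sigma>)"
  shows "\<Phi> = \<Psi>"
proof
  fix \<xi>
  show "\<Phi> \<xi> = \<Psi> \<xi>"
  proof (cases "\<xi> \<in> S \<theta>")
    case True
    define \<Delta> where "\<Delta> = (\<lambda>\<xi>. 1 * \<Phi> \<xi> + (- 1) * \<Psi> \<xi>)"
    have \<Delta>: "\<Delta> \<in> S_dual \<theta>"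
      unfolding \<Delta>_def using \<Phi> \<Psi> by (rule S_dual_lincomb)
    obtain C p where C: "0 \<le> C" "0 \<le> p" "\<And>\<xi>. \<xi> \<in> S \<theta> \<Longrightarrow> cmod (\<Delta> \<xi>) \<le> C * S_norm \<theta> p \<xi>"
      using S_dual_bounded[OF \<Delta>] by blast
    have "cmod (\<Delta> \<xi>) \<le> 0 + e" if e: "0 < e" for e
    proof -
      \<comment> \<open>The tolerance is divided by \<open>C + 1\<close> since \<open>C\<close> may
        be 0; the error is then at most \<open>C * (e / (C + 1)) \<le> e\<close>.\<close>
      obtain F where F: "finite F" "F \<subseteq> Gam"
        and le: "S_norm \<theta> p (\<lambda>\<omega>. \<xi> \<omega> - expansion F \<xi> \<omega>) \<le> e / (C + 1)"
        using expansion_approx[OF True C(2), of "e / (C + 1)"] e C(1) by auto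
      have "\<Delta> (expansion F \<xi>) = 0"
        using F eq by (simp only: S_dual_expansion[OF \<Delta> F]) (auto simp: \<Delta>_def intro!: sum.neutral)
      then have "cmod (\<Delta> \<xi>) = cmod (\<Delta> (\<lambda>\<omega>. \<xi> \<omega> - expansion F \<xi> \<omega>))"
        by (simp add: S_dual_diff_arg \<Delta> True expansion_in_S F)
      also have "\<dots> \<le> C * S_norm \<theta> p (\<lambda>\<omega>. \<xi> \<omega> - expansion F \<xi> \<omega>)"
        by (intro C(3) S_diff True expansion_in_S F)
      also have "\<dots> \<le> C * (e / (C + 1))"
        using le C(1) by (rule mult_left_mono)
      also have "\<dots> \<le> e"
        using e C(1) by (simp add: divide_simps)
      finally show ?thesis by simp
    qed
    then have "cmod (\<Delta> \<xi>) \<le> 0" by (rule field_le_epsilon)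
    then show ?thesis by (simp add: \<Delta>_def)
  qed (use \<Phi> \<Psi> in \<open>simp add: S_dual_outside\<close>)
qed

section \<open>The strong topology on the dual, and separately continuous forms\<close>

lemma zero_in_S_dual: "(\<lambda>_. 0) \<in> S_dual \<theta>"
  by (rule bounded_S_dual[where p=0 and C=0]) auto

abbreviation S_dual_nbhd :: "(rv \<Rightarrow> complex) \<Rightarrow> rv set \<Rightarrow> real \<Rightarrow> (rv \<Rightarrow> complex) set" where
  "S_dual_nbhd \<Phi> B r \<equiv> {\<Psi> \<in> S_dual \<theta>. (SUP \<xi>\<in>B. cmod (\<Psi> \<xi> - \<Phi> \<xi>)) < r}"

text \<open>Singletons are bounded sets, so the strong topology refines pointwise
  convergence.\<close>

lemma openin_S_dual_point_nbhd:
  assumes "\<Phi> \<in> S_dual \<theta>" "\<eta> \<in> S \<theta>" "0 < r"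
  shows "openin (S_dual_topology \<theta>) {\<Psi> \<in> S_dual \<theta>. cmod (\<Psi> \<eta> - \<Phi> \<eta>) < r}"
proof -
  have "openin (S_dual_topology \<theta>) (S_dual_nbhd \<Phi> {\<eta>} r)"
    unfolding S_dual_topology_def
  proof (rule topology_generated_by_Basis, intro CollectI exI conjI)
    show "S_bounded \<theta> {\<eta>}" using assms by (simp add: S_bounded_def)
  qed (use assms in simp_all)
  then show ?thesis by simp
qed

lemma topspace_S_dual [simp]: "topspace (S_dual_topology \<theta>) = S_dual \<theta>"
proof
  show "topspace (S_dual_topology \<theta>) \<subseteq> S_dual \<theta>"
    unfolding S_dual_topology_def by auto
  show "S_dual \<theta> \<subseteq> topspace (S_dual_topology \<theta>)"
  proof
    fix \<Phi> assume \<Phi>: "\<Phi> \<in> S_dual \<theta>"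
    show "\<Phi> \<in> topspace (S_dual_topology \<theta>)"
      using openin_subset[OF openin_S_dual_point_nbhd[OF \<Phi> zero_in_S, of 1]] \<Phi> by auto
  qed
qed

lemma evaluation_continuous:
  assumes \<eta>: "\<eta> \<in> S \<theta>"
  shows "continuous_map (S_dual_topology \<theta>) euclidean (\<lambda>\<Phi>. \<Phi> \<eta>)"
proof -
  have "openin (S_dual_topology \<theta>) {\<Phi> \<in> S_dual \<theta>. \<Phi> \<eta> \<in> V}" if V: "open V" for V
  proof (subst openin_subopen, intro ballI)
    fix \<Phi> assume "\<Phi> \<in> {\<Phi> \<in> S_dual \<theta>. \<Phi> \<eta> \<in> V}"
    then obtain e where \<Phi>: "\<Phi> \<in> S_dual \<theta>" and e: "0 < e" "ball (\<Phi> \<eta>) e \<subseteq> V"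
      using V open_contains_ball by blast
    let ?T = "{\<Psi> \<in> S_dual \<theta>. cmod (\<Psi> \<eta> - \<Phi> \<eta>) < e}"
    have "?T \<subseteq> {\<Phi> \<in> S_dual \<theta>. \<Phi> \<eta> \<in> V}"
      using e(2) by (auto simp: subset_iff dist_norm norm_minus_commute)
    then show "\<exists>T. openin (S_dual_topology \<theta>) T \<and> \<Phi> \<in> T \<and> T \<subseteq> {\<Phi> \<in> S_dual \<theta>. \<Phi> \<eta> \<in> V}"
      using openin_S_dual_point_nbhd[OF \<Phi> \<eta> e(1)] \<Phi> e(1) by (intro exI[of _ ?T]) simp
  qed
  then show ?thesis by (simp add: continuous_map)
qed

text \<open>Bilinearity, separate continuity and vanishing off the testing space in either argument
  are all carried by membership in \<open>S_dual\<close>. The first condition also covers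
  \<open>\<xi>\<close> outside that space, where operators take the value 0.\<close>

definition separately_dual :: "(rv \<Rightarrow> rv \<Rightarrow> complex) \<Rightarrow> bool" where
  "separately_dual T \<longleftrightarrow> (\<forall>\<xi>. T \<xi> \<in> S_dual \<theta>) \<and> (\<forall>\<eta>\<in>S \<theta>. (\<lambda>\<xi>. T \<xi> \<eta>) \<in> S_dual \<theta>)"

text \<open>Continuity in the first argument comes from composing \<open>T\<close> with evaluation
  at \<open>\<eta>\<close>, which is strongly continuous.\<close>

lemma S_operators_separately_dual:
  assumes T: "T \<in> S_operators \<theta>"
  shows "separately_dual T"
  unfolding separately_dual_def
proof (intro conjI allI ballI)
  have outside: "T \<xi> = (\<lambda>\<eta>. 0)" if "\<xi> \<notin> S \<theta>" for \<xi>
    using T that by (simp add: S_operators_def)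
  show "T \<xi> \<in> S_dual \<theta>" for \<xi>
    using T outside[of \<xi>] zero_in_S_dual by (cases "\<xi> \<in> S \<theta>") (simp_all add: S_operators_def)
  fix \<eta> assume \<eta>: "\<eta> \<in> S \<theta>"
  have "continuous_map (S_topology \<theta>) (S_dual_topology \<theta>) T"
    using T by (simp add: S_operators_def)
  then have "continuous_map (S_topology \<theta>) euclidean (\<lambda>\<xi>. T \<xi> \<eta>)"
    using continuous_map_compose[OF _ evaluation_continuous[OF \<eta>]] by (simp add: o_def)
  then show "(\<lambda>\<xi>. T \<xi> \<eta>) \<in> S_dual \<theta>"
    using T outside by (simp add: S_dual_def S_operators_def)
qed

lemma separately_dual_lincomb:
  assumes "separately_dual T" "separately_dual U"
  shows "separately_dual (\<lambda>\<xi> \<eta>. a * T \<xi> \<eta> + b * U \<xi> \<eta>)"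
  using assms by (simp add: separately_dual_def S_dual_lincomb)

text \<open>Two uses of \<open>S_dual_eqI\<close>: first in the second argument with the first one
  equal to \<open>Z \<theta> \<sigma>\<close>, then in the first argument with \<open>\<eta>\<close>
  fixed.\<close>

lemma separately_dual_eqI:
  assumes T: "separately_dual T" and U: "separately_dual U"
    and eq: "\<And>\<sigma> \<tau>. \<sigma> \<in> Gam \<Longrightarrow> \<tau> \<in> Gam \<Longrightarrow> fock2D \<theta> T \<sigma> \<tau> = fock2D \<theta> U \<sigma> \<tau>"
  shows "T = U"
proof (intro ext)
  fix \<xi> \<eta>
  show "T \<xi> \<eta> = U \<xi> \<eta>"
  proof (cases "\<eta> \<in> S \<theta>")
    case True
    have "T (Z \<theta> \<sigma>) = U (Z \<theta> \<sigma>)" if "\<sigma> \<in> Gam" for \<sigma>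
      using T U eq that by (intro S_dual_eqI) (auto simp: separately_dual_def fock2D_def)
    then have "(\<lambda>\<xi>. T \<xi> \<eta>) = (\<lambda>\<xi>. U \<xi> \<eta>)"
      using T U True by (intro S_dual_eqI) (auto simp: separately_dual_def)
    then show ?thesis by (rule fun_cong)
  next
    case False
    then show ?thesis
      using T U S_dual_outside[of "T \<xi>" \<eta>] S_dual_outside[of "U \<xi>" \<eta>]
      by (simp add: separately_dual_def)
  qed
qed

subsection \<open>Operators with a prescribed 2D-Fock transform\<close>

definition lam_const :: real where
  "lam_const = sqrt (\<Sum>\<^sub>\<infinity>\<sigma>\<in>Gam. (lam \<sigma> powr - 1)\<^sup>2)"

lemma lam_const_nonneg: "0 \<le> lam_const"
  by (simp add: lam_const_def infsum_nonneg)

text \<open>Writing \<open>lam \<sigma> powr p\<close> as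
  \<open>lam \<sigma> powr (p + 1) * lam \<sigma> powr - 1\<close>, the first factor joins the
  coefficient to form \<open>wcoef (p + 1)\<close> and the second is square-summable, so
  Cauchy-Schwarz applies. The price is one step in the index.\<close>

lemma
  fixes g :: "nat set \<Rightarrow> complex"
  assumes \<xi>: "\<xi> \<in> S \<theta>" and p: "0 \<le> p" and g: "\<And>\<sigma>. \<sigma> \<in> Gam \<Longrightarrow> cmod (g \<sigma>) \<le> C * lam \<sigma> powr p"
  shows coef_mult_summable: "(\<lambda>\<sigma>. coef \<xi> \<sigma> * g \<sigma>) summable_on Gam"
    and coef_mult_infsum_le:
      "cmod (\<Sum>\<^sub>\<infinity>\<sigma>\<in>Gam. coef \<xi> \<sigma> * g \<sigma>) \<le> C * lam_const * S_norm \<theta> (p + 1) \<xi>"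
proof -
  let ?h = "\<lambda>\<sigma>. wcoef (p + 1) \<xi> \<sigma> * lam \<sigma> powr - 1"
  have w: "(\<lambda>\<sigma>. (wcoef (p + 1) \<xi> \<sigma>)\<^sup>2) summable_on Gam"
    using \<xi> p by (intro wcoef_summable) auto
  have h: "?h summable_on Gam"
    by (intro l2_mult_summable w lam_inverse_square_summable) (auto simp: wcoef_nonneg)
  then have Ch: "(\<lambda>\<sigma>. C * ?h \<sigma>) summable_on Gam"
    by (rule summable_on_cmult_right)
  have le: "cmod (coef \<xi> \<sigma> * g \<sigma>) \<le> C * ?h \<sigma>" if "\<sigma> \<in> Gam" for \<sigma>
  proof -
    have "cmod (coef \<xi> \<sigma> * g \<sigma>) \<le> cmod (coef \<xi> \<sigma>) * (C * lam \<sigma> powr p)"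
      unfolding norm_mult using g[OF that] by (rule mult_left_mono) simp
    moreover have "lam \<sigma> powr p = lam \<sigma> powr (p + 1) * lam \<sigma> powr - 1"
      using lam_pos[of \<sigma>] by (simp add: powr_add)
    ultimately show ?thesis by (simp add: wcoef_def mult_ac)
  qed
  have abs: "(\<lambda>\<sigma>. cmod (coef \<xi> \<sigma> * g \<sigma>)) summable_on Gam"
    using Ch le by (rule summable_on_comparison_test) simp_all
  then show "(\<lambda>\<sigma>. coef \<xi> \<sigma> * g \<sigma>) summable_on Gam"
    by (rule abs_summable_summable)
  \<comment> \<open>The sign of \<open>C\<close> is read off from the bound at the empty set, where
    the weight is 1.\<close>
  have "0 \<le> C * lam {} powr p"
    using g[of "{}"] order_trans[OF norm_ge_zero] by (auto simp: Gam_def)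
  then have C: "0 \<le> C" by (simp add: lam_def)
  have "cmod (\<Sum>\<^sub>\<infinity>\<sigma>\<in>Gam. coef \<xi> \<sigma> * g \<sigma>) \<le> (\<Sum>\<^sub>\<infinity>\<sigma>\<in>Gam. cmod (coef \<xi> \<sigma> * g \<sigma>))"
    using abs by (rule norm_infsum_bound)
  also have "\<dots> \<le> (\<Sum>\<^sub>\<infinity>\<sigma>\<in>Gam. C * ?h \<sigma>)"
    using abs Ch le by (rule infsum_mono)
  also have "\<dots> = C * (\<Sum>\<^sub>\<infinity>\<sigma>\<in>Gam. ?h \<sigma>)"
    by (rule infsum_cmult_right')
  also have "\<dots> \<le> C * (S_norm \<theta> (p + 1) \<xi> * lam_const)"
    unfolding S_norm_eq lam_const_def using C
    by (intro mult_left_mono l2_Cauchy_Schwarz w lam_inverse_square_summable) (auto simp: wcoef_nonneg)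
  finally show "cmod (\<Sum>\<^sub>\<infinity>\<sigma>\<in>Gam. coef \<xi> \<sigma> * g \<sigma>) \<le> C * lam_const * S_norm \<theta> (p + 1) \<xi>"
    by (simp add: mult_ac)
qed

lemma infsum_coef_Z:
  fixes g :: "nat set \<Rightarrow> complex"
  assumes "\<sigma> \<in> Gam"
  shows "(\<Sum>\<^sub>\<infinity>\<rho>\<in>Gam. coef (Z \<theta> \<sigma>) \<rho> * g \<rho>) = g \<sigma>"
proof -
  have "((\<lambda>\<rho>. coef (Z \<theta> \<sigma>) \<rho> * g \<rho>) has_sum g \<sigma>) Gam"
    using assms by (intro has_sum_finite_neutralI[where B="{\<sigma>}"]) (auto simp: Z_orthonormal)
  then show ?thesis by (rule infsumI)
qed

text \<open>The double series is summed iteratively, which makes linearity in each argument immediate.\<close>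

definition kernel_operator :: "(nat set \<Rightarrow> nat set \<Rightarrow> complex) \<Rightarrow> rv \<Rightarrow> rv \<Rightarrow> complex" where
  "kernel_operator G \<xi> \<eta> = (if \<xi> \<in> S \<theta> \<and> \<eta> \<in> S \<theta>
     then \<Sum>\<^sub>\<infinity>\<sigma>\<in>Gam. coef \<xi> \<sigma> * (\<Sum>\<^sub>\<infinity>\<tau>\<in>Gam. coef \<eta> \<tau> * G \<sigma> \<tau>) else 0)"

lemma fock2D_kernel_operator:
  "\<sigma> \<in> Gam \<Longrightarrow> \<tau> \<in> Gam \<Longrightarrow> fock2D \<theta> (kernel_operator G) \<sigma> \<tau> = G \<sigma> \<tau>"
  by (simp add: fock2D_def kernel_operator_def Z_in_S infsum_coef_Z)

text \<open>Applying the coefficient estimate to the inner and then to the outer series bounds the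
  form by \<open>D\<close> times the norms of index \<open>p + 1\<close> of both arguments. This
  puts each \<open>?T \<xi>\<close> in the dual and, being uniform over bounded sets of
  \<open>\<eta>\<close>, gives continuity into the strong dual.\<close>

lemma kernel_operator_in_S_operators:
  assumes p: "0 \<le> p" and C: "0 \<le> C"
    and G: "\<And>\<sigma> \<tau>. \<sigma> \<in> Gam \<Longrightarrow> \<tau> \<in> Gam \<Longrightarrow> cmod (G \<sigma> \<tau>) \<le> C * lam \<sigma> powr p * lam \<tau> powr p"
  shows "kernel_operator G \<in> S_operators \<theta>"
proof -
  let ?T = "kernel_operator G" and ?q = "p + 1"
  let ?H = "\<lambda>\<eta> \<sigma>. \<Sum>\<^sub>\<infinity>\<tau>\<in>Gam. coef \<eta> \<tau> * G \<sigma> \<tau>"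
  have q: "0 \<le> ?q" using p by simp
  have H_summable: "(\<lambda>\<tau>. coef \<eta> \<tau> * G \<sigma> \<tau>) summable_on Gam" if "\<eta> \<in> S \<theta>" "\<sigma> \<in> Gam" for \<eta> \<sigma>
    using that p G by (intro coef_mult_summable[where p=p])
  \<comment> \<open>The inner sum again grows at most like \<open>lam \<sigma> powr p\<close>, so
    the same estimate can be used for the outer series.\<close>
  have H_le: "cmod (?H \<eta> \<sigma>) \<le> (C * lam_const * S_norm \<theta> ?q \<eta>) * lam \<sigma> powr p"
    if "\<eta> \<in> S \<theta>" "\<sigma> \<in> Gam" for \<eta> \<sigma>
    using coef_mult_infsum_le[OF that(1) p G[OF that(2)]] by (simp add: mult_ac)
  have T_summable: "(\<lambda>\<sigma>. coef \<xi> \<sigma> * ?H \<eta> \<sigma>) summable_on Gam" if "\<xi> \<in> S \<theta>" "\<eta> \<in> S \<theta>" for \<xi> \<eta>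
    using coef_mult_summable[OF that(1) p H_le[OF that(2)]] .
  define D where "D = C * lam_const * lam_const"
  have D: "0 \<le> D" using C lam_const_nonneg by (simp add: D_def)
  have T_le: "cmod (?T \<xi> \<eta>) \<le> D * S_norm \<theta> ?q \<xi> * S_norm \<theta> ?q \<eta>" if "\<xi> \<in> S \<theta>" "\<eta> \<in> S \<theta>" for \<xi> \<eta>
    using coef_mult_infsum_le[OF that(1) p H_le[OF that(2)]] that
    by (simp add: kernel_operator_def D_def mult_ac)
  have T_left: "?T (\<lambda>\<omega>. a * \<xi> \<omega> + b * \<xi>' \<omega>) \<eta> = a * ?T \<xi> \<eta> + b * ?T \<xi>' \<eta>"
    if "\<xi> \<in> S \<theta>" "\<xi>' \<in> S \<theta>" for \<xi> \<xi>' \<eta> a b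
  proof (cases "\<eta> \<in> S \<theta>")
    case True
    have "coef (\<lambda>\<omega>. a * \<xi> \<omega> + b * \<xi>' \<omega>) \<sigma> * ?H \<eta> \<sigma>
        = a * (coef \<xi> \<sigma> * ?H \<eta> \<sigma>) + b * (coef \<xi>' \<sigma> * ?H \<eta> \<sigma>)" for \<sigma>
      by (simp add: coef_lincomb that algebra_simps)
    then show ?thesis
      using that True by (simp add: kernel_operator_def S_lincomb infsum_lincomb T_summable)
  qed (simp add: kernel_operator_def)
  have T_right: "?T \<xi> (\<lambda>\<omega>. a * \<eta> \<omega> + b * \<eta>' \<omega>) = a * ?T \<xi> \<eta> + b * ?T \<xi> \<eta>'"
    if \<xi>: "\<xi> \<in> S \<theta>" and \<eta>: "\<eta> \<in> S \<theta>" "\<eta>' \<in> S \<theta>" for \<xi> \<eta> \<eta>' a b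
  proof -
    have "?H (\<lambda>\<omega>. a * \<eta> \<omega> + b * \<eta>' \<omega>) \<sigma> = a * ?H \<eta> \<sigma> + b * ?H \<eta>' \<sigma>" if "\<sigma> \<in> Gam" for \<sigma>
    proof -
      have "coef (\<lambda>\<omega>. a * \<eta> \<omega> + b * \<eta>' \<omega>) \<tau> * G \<sigma> \<tau>
          = a * (coef \<eta> \<tau> * G \<sigma> \<tau>) + b * (coef \<eta>' \<tau> * G \<sigma> \<tau>)" for \<tau>
        by (simp add: coef_lincomb \<eta> algebra_simps)
      then show ?thesis
        by (simp add: infsum_lincomb H_summable \<eta> that)
    qed
    then have "(\<Sum>\<^sub>\<infinity>\<sigma>\<in>Gam. coef \<xi> \<sigma> * ?H (\<lambda>\<omega>. a * \<eta> \<omega> + b * \<eta>' \<omega>) \<sigma>)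
        = (\<Sum>\<^sub>\<infinity>\<sigma>\<in>Gam. a * (coef \<xi> \<sigma> * ?H \<eta> \<sigma>) + b * (coef \<xi> \<sigma> * ?H \<eta>' \<sigma>))"
      by (intro infsum_cong) (simp add: algebra_simps)
    then show ?thesis
      using \<xi> \<eta> by (simp add: kernel_operator_def S_lincomb infsum_lincomb T_summable)
  qed
  have T_dual: "?T \<xi> \<in> S_dual \<theta>" if \<xi>: "\<xi> \<in> S \<theta>" for \<xi>
    by (rule bounded_S_dual[OF _ T_right[OF \<xi>] q T_le[OF \<xi>]]) (simp add: kernel_operator_def)
  have "continuous_map (S_topology \<theta>) (S_dual_topology \<theta>) ?T"
    unfolding S_dual_topology_def
  \<comment> \<open>It suffices that preimages of the generating neighbourhoods are open.\<close>
  proof (rule continuous_on_generated_topo)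
    show "?T ` topspace (S_topology \<theta>) \<subseteq> \<Union>{S_dual_nbhd \<Phi> B r | \<Phi> B r.
        \<Phi> \<in> S_dual \<theta> \<and> S_bounded \<theta> B \<and> B \<noteq> {} \<and> 0 < r}"
      using T_dual topspace_S_dual unfolding S_dual_topology_def by auto
    fix U assume "U \<in> {S_dual_nbhd \<Phi> B r | \<Phi> B r.
        \<Phi> \<in> S_dual \<theta> \<and> S_bounded \<theta> B \<and> B \<noteq> {} \<and> 0 < r}"
    then obtain \<Phi> B r where U: "U = S_dual_nbhd \<Phi> B r" and \<Phi>: "\<Phi> \<in> S_dual \<theta>"
      and B: "S_bounded \<theta> B" "B \<noteq> {}"
      by auto
    have B_S: "\<eta> \<in> S \<theta>" if "\<eta> \<in> B" for \<eta>
      using that B(1) by (auto simp: S_bounded_def)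
    obtain M where M: "\<And>\<eta>. \<eta> \<in> B \<Longrightarrow> S_norm \<theta> ?q \<eta> \<le> M"
      using B(1) q unfolding S_bounded_def bdd_above_def by blast
    have M0: "0 \<le> M"
      using B(2) M S_norm_nonneg order_trans by blast
    show "openin (S_topology \<theta>) (?T -` U \<inter> topspace (S_topology \<theta>))"
      unfolding openin_S_iff topspace_S
    proof (intro conjI ballI)
      fix \<xi>\<^sub>0 assume "\<xi>\<^sub>0 \<in> ?T -` U \<inter> S \<theta>"
      then have \<xi>\<^sub>0: "\<xi>\<^sub>0 \<in> S \<theta>" and less: "(SUP \<eta>\<in>B. cmod (?T \<xi>\<^sub>0 \<eta> - \<Phi> \<eta>)) < r"
        by (auto simp: U)
      define s where "s = (SUP \<eta>\<in>B. cmod (?T \<xi>\<^sub>0 \<eta> - \<Phi> \<eta>))"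
      \<comment> \<open>Half of the gap is kept in reserve: a supremum over \<open>B\<close> only
        inherits a non-strict bound, and \<open>d + s\<close> is still strictly below
        \<open>r\<close>.\<close>
      define d where "d = (r - s) / 2"
      have d: "0 < d" "d + s < r" using less by (auto simp: d_def s_def field_simps)
      \<comment> \<open>As a continuous functional the difference is bounded on \<open>B\<close>;
        this makes the supremum \<open>s\<close> a genuine upper bound.\<close>
      have "(\<lambda>\<eta>. 1 * ?T \<xi>\<^sub>0 \<eta> + (- 1) * \<Phi> \<eta>) \<in> S_dual \<theta>"
        using T_dual[OF \<xi>\<^sub>0] \<Phi> by (rule S_dual_lincomb)
      then obtain C' p' where C': "0 \<le> C'" "0 \<le> p'"
        "\<And>\<eta>. \<eta> \<in> S \<theta> \<Longrightarrow> cmod (1 * ?T \<xi>\<^sub>0 \<eta> + (- 1) * \<Phi> \<eta>) \<le> C' * S_norm \<theta> p' \<eta>"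
        using S_dual_bounded by blast
      obtain M' where M': "\<And>\<eta>. \<eta> \<in> B \<Longrightarrow> S_norm \<theta> p' \<eta> \<le> M'"
        using B(1) C'(2) unfolding S_bounded_def bdd_above_def by blast
      have bdd: "bdd_above ((\<lambda>\<eta>. cmod (?T \<xi>\<^sub>0 \<eta> - \<Phi> \<eta>)) ` B)"
      proof (rule bdd_aboveI2)
        fix \<eta> assume "\<eta> \<in> B"
        then show "cmod (?T \<xi>\<^sub>0 \<eta> - \<Phi> \<eta>) \<le> C' * M'"
          using C'(3)[OF B_S] mult_left_mono[OF M' C'(1)] by fastforce
      qed
      \<comment> \<open>Moving \<open>\<xi>\<^sub>0\<close> by less than \<open>?e\<close> changes
        the form by at most \<open>D * ?e * M \<le> d\<close> on \<open>B\<close>; adding 1 keeps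
        the denominator positive.\<close>
      let ?e = "d / (D * M + 1)"
      have DM: "0 < D * M + 1" using D M0 by (simp add: add_nonneg_pos)
      have "\<xi> \<in> ?T -` U" if "\<xi> \<in> S_ball ?q \<xi>\<^sub>0 ?e" for \<xi>
      proof -
        have \<xi>: "\<xi> \<in> S \<theta>" and near: "S_norm \<theta> ?q (\<lambda>\<omega>. \<xi> \<omega> - \<xi>\<^sub>0 \<omega>) < ?e"
          using that by auto
        have "cmod (?T \<xi> \<eta> - \<Phi> \<eta>) \<le> d + s" if \<eta>: "\<eta> \<in> B" for \<eta>
        proof -
          let ?n = "S_norm \<theta> ?q (\<lambda>\<omega>. \<xi> \<omega> - \<xi>\<^sub>0 \<omega>)"
          have "?T \<xi> \<eta> - \<Phi> \<eta> = ?T (\<lambda>\<omega>. \<xi> \<omega> - \<xi>\<^sub>0 \<omega>) \<eta> + (?T \<xi>\<^sub>0 \<eta> - \<Phi> \<eta>)"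
            using T_left[OF \<xi> \<xi>\<^sub>0, of 1 "- 1"] by simp
          then have "cmod (?T \<xi> \<eta> - \<Phi> \<eta>)
              \<le> cmod (?T (\<lambda>\<omega>. \<xi> \<omega> - \<xi>\<^sub>0 \<omega>) \<eta>) + cmod (?T \<xi>\<^sub>0 \<eta> - \<Phi> \<eta>)"
            by (metis norm_triangle_ineq)
          moreover have "cmod (?T \<xi>\<^sub>0 \<eta> - \<Phi> \<eta>) \<le> s"
            unfolding s_def using \<eta> bdd by (rule cSUP_upper)
          moreover have "cmod (?T (\<lambda>\<omega>. \<xi> \<omega> - \<xi>\<^sub>0 \<omega>) \<eta>) \<le> d"
          proof -
            have "cmod (?T (\<lambda>\<omega>. \<xi> \<omega> - \<xi>\<^sub>0 \<omega>) \<eta>) \<le> D * ?n * S_norm \<theta> ?q \<eta>"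
              using S_diff[OF \<xi> \<xi>\<^sub>0] B_S[OF \<eta>] by (rule T_le)
            also have "\<dots> \<le> D * ?n * M"
              using M[OF \<eta>] D S_norm_nonneg by (intro mult_left_mono) auto
            also have "\<dots> \<le> (D * M + 1) * ?n"
              using S_norm_nonneg by (simp add: algebra_simps)
            also have "\<dots> \<le> d"
              using near DM by (simp add: pos_less_divide_eq mult.commute)
            finally show ?thesis .
          qed
          ultimately show ?thesis by linarith
        qed
        then have "(SUP \<eta>\<in>B. cmod (?T \<xi> \<eta> - \<Phi> \<eta>)) \<le> d + s"
          using B(2) by (intro cSUP_least)
        then show ?thesis using T_dual[OF \<xi>] d by (simp add: U)
      qed
      then have "S_ball ?q \<xi>\<^sub>0 ?e \<subseteq> ?T -` U \<inter> S \<theta>" by blast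
      moreover have "0 < ?e" using d(1) DM by simp
      ultimately show "\<exists>p\<ge>0. \<exists>r>0. S_ball p \<xi>\<^sub>0 r \<subseteq> ?T -` U \<inter> S \<theta>"
        using q by blast
    qed auto
  qed
  then show ?thesis
    unfolding S_operators_def using T_dual T_left
    by (auto simp: kernel_operator_def fun_eq_iff)
qed

section \<open>Existence, uniqueness and linearity of spectral integrals\<close>

lemma
  assumes \<Phi>: "spectral_integrable \<theta> \<pi> \<Phi>"
  shows spectral_integral_in_S_operators: "spectral_integral \<theta> \<pi> \<Phi> \<in> S_operators \<theta>"
    and fock2D_spectral_integral: "\<sigma> \<in> Gam \<Longrightarrow> \<tau> \<in> Gam \<Longrightarrow>
      fock2D \<theta> (spectral_integral \<theta> \<pi> \<Phi>) \<sigma> \<tau> = \<Phi> (spectral_density \<theta> \<pi> \<sigma> \<tau>)"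
proof -
  let ?P = "\<lambda>T. T \<in> S_operators \<theta> \<and>
    (\<forall>\<sigma>\<in>Gam. \<forall>\<tau>\<in>Gam. fock2D \<theta> T \<sigma> \<tau> = \<Phi> (spectral_density \<theta> \<pi> \<sigma> \<tau>))"
  obtain C p where "0 \<le> C" "0 \<le> p" "\<And>\<sigma> \<tau>. \<sigma> \<in> Gam \<Longrightarrow> \<tau> \<in> Gam \<Longrightarrow>
      cmod (\<Phi> (spectral_density \<theta> \<pi> \<sigma> \<tau>)) \<le> C * lam \<sigma> powr p * lam \<tau> powr p"
    using \<Phi> unfolding spectral_integrable_def by blast
  \<comment> \<open>Integrability is exactly the growth bound required of a kernel, so the kernel
    operator is the witness for existence.\<close>
  then have "?P (kernel_operator (\<lambda>\<sigma> \<tau>. \<Phi> (spectral_density \<theta> \<pi> \<sigma> \<tau>)))"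
    using kernel_operator_in_S_operators[of p C] fock2D_kernel_operator by simp
  \<comment> \<open>Uniqueness, through separately continuous forms, makes the definite description
    in \<open>spectral_integral\<close> meaningful.\<close>
  then have "\<exists>!T. ?P T"
    by (intro ex_ex1I exI) (auto intro!: separately_dual_eqI S_operators_separately_dual)
  then have "?P (spectral_integral \<theta> \<pi> \<Phi>)"
    unfolding spectral_integral_def by (rule theI')
  then show "spectral_integral \<theta> \<pi> \<Phi> \<in> S_operators \<theta>"
    "\<sigma> \<in> Gam \<Longrightarrow> \<tau> \<in> Gam \<Longrightarrow>
      fock2D \<theta> (spectral_integral \<theta> \<pi> \<Phi>) \<sigma> \<tau> = \<Phi> (spectral_density \<theta> \<pi> \<sigma> \<tau>)"
    by auto
qed

text \<open>As the weights are at least 1, both growth bounds can be raised to the exponent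
  \<open>max p q\<close>, and the triangle inequality combines the constants.\<close>

lemma spectral_integrable_lincomb:
  assumes \<Phi>: "spectral_integrable \<theta> \<pi> \<Phi>" and \<Psi>: "spectral_integrable \<theta> \<pi> \<Psi>"
  shows "spectral_integrable \<theta> \<pi> (\<lambda>\<xi>. \<alpha> * \<Phi> \<xi> + \<beta> * \<Psi> \<xi>)"
proof -
  let ?\<phi> = "spectral_density \<theta> \<pi>"
  obtain C p where C: "0 \<le> C" "0 \<le> p" "\<And>\<sigma> \<tau>. \<sigma> \<in> Gam \<Longrightarrow> \<tau> \<in> Gam \<Longrightarrow>
      cmod (\<Phi> (?\<phi> \<sigma> \<tau>)) \<le> C * lam \<sigma> powr p * lam \<tau> powr p"
    using \<Phi> unfolding spectral_integrable_def by blast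
  obtain D q where D: "0 \<le> D" "0 \<le> q" "\<And>\<sigma> \<tau>. \<sigma> \<in> Gam \<Longrightarrow> \<tau> \<in> Gam \<Longrightarrow>
      cmod (\<Psi> (?\<phi> \<sigma> \<tau>)) \<le> D * lam \<sigma> powr q * lam \<tau> powr q"
    using \<Psi> unfolding spectral_integrable_def by blast
  define r where "r = max p q"
  have weaken: "E * lam \<sigma> powr s * lam \<tau> powr s \<le> E * lam \<sigma> powr r * lam \<tau> powr r"
    if "0 \<le> E" "s \<le> r" for E s \<sigma> \<tau>
    using that by (intro mult_mono lam_powr_mono) auto
  let ?K = "cmod \<alpha> * C + cmod \<beta> * D"
  have "cmod (\<alpha> * \<Phi> (?\<phi> \<sigma> \<tau>) + \<beta> * \<Psi> (?\<phi> \<sigma> \<tau>)) \<le> ?K * lam \<sigma> powr r * lam \<tau> powr r"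
    if "\<sigma> \<in> Gam" "\<tau> \<in> Gam" for \<sigma> \<tau>
  proof -
    have "cmod (\<Phi> (?\<phi> \<sigma> \<tau>)) \<le> C * lam \<sigma> powr r * lam \<tau> powr r"
      using C(3)[OF that] weaken[OF C(1)] by (rule order_trans) (simp add: r_def)
    moreover have "cmod (\<Psi> (?\<phi> \<sigma> \<tau>)) \<le> D * lam \<sigma> powr r * lam \<tau> powr r"
      using D(3)[OF that] weaken[OF D(1)] by (rule order_trans) (simp add: r_def)
    ultimately have "cmod \<alpha> * cmod (\<Phi> (?\<phi> \<sigma> \<tau>)) + cmod \<beta> * cmod (\<Psi> (?\<phi> \<sigma> \<tau>)) \<le>
        cmod \<alpha> * (C * lam \<sigma> powr r * lam \<tau> powr r) + cmod \<beta> * (D * lam \<sigma> powr r * lam \<tau> powr r)"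
      by (intro add_mono mult_left_mono) auto
    then show ?thesis
      using norm_triangle_ineq[of "\<alpha> * \<Phi> (?\<phi> \<sigma> \<tau>)" "\<beta> * \<Psi> (?\<phi> \<sigma> \<tau>)"]
      by (simp add: norm_mult algebra_simps)
  qed
  moreover have "0 \<le> ?K" "0 \<le> r"
    using C D by (auto simp: r_def)
  ultimately show ?thesis
    using \<Phi> \<Psi> S_dual_lincomb unfolding spectral_integrable_def by blast
qed

text \<open>The spectral densities depend on \<open>\<pi>\<close> alone, so evaluating functionals
  at them is linear in the functional and both sides have the same 2D-Fock transform.\<close>

lemma spectral_integral_lincomb:
  assumes \<Phi>: "spectral_integrable \<theta> \<pi> \<Phi>" and \<Psi>: "spectral_integrable \<theta> \<pi> \<Psi>"
  shows "spectral_integral \<theta> \<pi> (\<lambda>\<xi>. \<alpha> * \<Phi> \<xi> + \<beta> * \<Psi> \<xi>) =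
    (\<lambda>\<xi> \<eta>. \<alpha> * spectral_integral \<theta> \<pi> \<Phi> \<xi> \<eta> + \<beta> * spectral_integral \<theta> \<pi> \<Psi> \<xi> \<eta>)"
proof (rule separately_dual_eqI)
  note \<Phi>\<Psi> = spectral_integrable_lincomb[OF \<Phi> \<Psi>, of \<alpha> \<beta>]
  note sep = S_operators_separately_dual[OF spectral_integral_in_S_operators]
  show "separately_dual (spectral_integral \<theta> \<pi> (\<lambda>\<xi>. \<alpha> * \<Phi> \<xi> + \<beta> * \<Psi> \<xi>))"
    using \<Phi>\<Psi> by (rule sep)
  show "separately_dual (\<lambda>\<xi> \<eta>. \<alpha> * spectral_integral \<theta> \<pi> \<Phi> \<xi> \<eta> + \<beta> * spectral_integral \<theta> \<pi> \<Psi> \<xi> \<eta>)"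
    by (intro separately_dual_lincomb sep \<Phi> \<Psi>)
  fix \<sigma> \<tau> assume "\<sigma> \<in> Gam" "\<tau> \<in> Gam"
  then show "fock2D \<theta> (spectral_integral \<theta> \<pi> (\<lambda>\<xi>. \<alpha> * \<Phi> \<xi> + \<beta> * \<Psi> \<xi>)) \<sigma> \<tau> =
      fock2D \<theta> (\<lambda>\<xi> \<eta>. \<alpha> * spectral_integral \<theta> \<pi> \<Phi> \<xi> \<eta> + \<beta> * spectral_integral \<theta> \<pi> \<Psi> \<xi> \<eta>) \<sigma> \<tau>"
    using fock2D_spectral_integral[OF \<Phi>] fock2D_spectral_integral[OF \<Psi>]
      fock2D_spectral_integral[OF \<Phi>\<Psi>]
    by (simp add: fock2D_def)
qed

end

theorem theorem4p3:
  fixes \<theta> :: "nat \<Rightarrow> real"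
    and \<pi> :: "path set \<Rightarrow> rv \<Rightarrow> rv"
    and \<Phi> \<Psi> :: "rv \<Rightarrow> complex"
    and \<alpha> \<beta> :: complex
  assumes "\<And>n. 0 < \<theta> n" and "\<And>n. \<theta> n < 1"
    and "spectral_measure \<theta> \<pi>" and "S_smooth \<theta> \<pi>"
    and "\<Phi> \<in> S_dual \<theta>" and "spectral_integrable \<theta> \<pi> \<Phi>"
    and "\<Psi> \<in> S_dual \<theta>" and "spectral_integrable \<theta> \<pi> \<Psi>"
  shows "spectral_integrable \<theta> \<pi> (\<lambda>\<xi>. \<alpha> * \<Phi> \<xi> + \<beta> * \<Psi> \<xi>) \<and>
    spectral_integral \<theta> \<pi> (\<lambda>\<xi>. \<alpha> * \<Phi> \<xi> + \<beta> * \<Psi> \<xi>) =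
      (\<lambda>\<xi> \<eta>. \<alpha> * spectral_integral \<theta> \<pi> \<Phi> \<xi> \<eta> + \<beta> * spectral_integral \<theta> \<pi> \<Psi> \<xi> \<eta>)"
proof -
  interpret bernoulli_space \<theta>
    using assms(1,2) by unfold_locales
  show ?thesis
    using spectral_integrable_lincomb spectral_integral_lincomb assms(6,8) by blast
qed

end
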